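(* In the Euclidean plane, let ${\rm O},{\rm A},{\rm B}$ be three distinct points. For every $T>0$ there are exactly two simple Keplerian arcs around ${\rm O}$ going from ${\rm A}$ to ${\rm B}$ with elapsed time $T$.
   Context: Kepler problem normalized as $\ddot q=-q/|q|^3$, $q\in\mathbb R^2$, fixed center ${\rm O}$. A Keplerian arc from ${\rm A}$ to ${\rm B}$ is a solution on a compact time interval $[t_{\rm A},t_{\rm B}]$, $t_{\rm A}<t_{\rm B}$, with $q(t_{\rm A})={\rm A}$, $q(t_{\rm B})={\rm B}$; elapsed time $t_{\rm B}-t_{\rm A}$. Rectilinear motions are extended after collision with ${\rm O}$ (bounce back along the same ray with the same energy). An arc is indirect if its convex hull contains ${\rm O}$, direct otherwise. An indirect arc is multi-revolution if the orbit is periodic and the elapsed time exceeds a period. A Keplerian arc is simple if it is not multi-revolution, i.e. it does not pass twice through the same point with the same velocity (direct arcs and simple indirect arcs). *)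

theory Defs
  imports "HOL-Analysis.Analysis"
begin

text \<open>Kepler problem with fixed attracting centre O in the plane:
  q'' = -(q - c) / |q - c|^3.  A Keplerian arc on [t0,t1] is a continuous
  curve which hits c only at finitely many (collision) times, satisfies the
  Kepler equation (twice differentiably, one-sided at the endpoints) at all
  other times, has constant energy, and, if it collides with c, stays on a
  single ray issuing from c (rectilinear motion extended by bouncing back
  along the same ray with the same energy).\<close>

definition kepler_arc :: "real^2 \<Rightarrow> (real \<Rightarrow> real^2) \<Rightarrow> real \<Rightarrow> real \<Rightarrow> bool" where
  "kepler_arc c q t0 t1 \<longleftrightarrow>
     t0 < t1 \<and>
     continuous_on {t0..t1} q \<and>
     finite {t \<in> {t0..t1}. q t = c} \<and>
     (\<exists>v E.
        (\<forall>t \<in> {t0..t1}. q t \<noteq> c \<longrightarrow>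
            (q has_vector_derivative v t) (at t within {t0..t1}) \<and>
            (v has_vector_derivative (- (1 / norm (q t - c) ^ 3) *\<^sub>R (q t - c)))
               (at t within {t0..t1}) \<and>
            norm (v t) ^ 2 / 2 - 1 / norm (q t - c) = E)) \<and>
     ((\<exists>t \<in> {t0..t1}. q t = c) \<longrightarrow>
        (\<exists>u. \<forall>t \<in> {t0..t1}. \<exists>s\<ge>0. q t - c = s *\<^sub>R u))"

definition indirect_arc :: "real^2 \<Rightarrow> (real \<Rightarrow> real^2) \<Rightarrow> real \<Rightarrow> real \<Rightarrow> bool" where
  "indirect_arc c q t0 t1 \<longleftrightarrow> c \<in> convex hull (q ` {t0..t1})"

definition direct_arc :: "real^2 \<Rightarrow> (real \<Rightarrow> real^2) \<Rightarrow> real \<Rightarrow> real \<Rightarrow> bool" where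
  "direct_arc c q t0 t1 \<longleftrightarrow> \<not> indirect_arc c q t0 t1"

definition multi_revolution :: "real^2 \<Rightarrow> (real \<Rightarrow> real^2) \<Rightarrow> real \<Rightarrow> real \<Rightarrow> bool" where
  "multi_revolution c q t0 t1 \<longleftrightarrow>
     indirect_arc c q t0 t1 \<and>
     (\<exists>P>0. P < t1 - t0 \<and>
        (\<forall>t. t \<in> {t0..t1} \<and> t + P \<in> {t0..t1} \<longrightarrow> q (t + P) = q t))"

definition simple_kepler_arc :: "real^2 \<Rightarrow> (real \<Rightarrow> real^2) \<Rightarrow> real \<Rightarrow> real \<Rightarrow> bool" where
  "simple_kepler_arc c q t0 t1 \<longleftrightarrow> kepler_arc c q t0 t1 \<and> \<not> multi_revolution c q t0 t1"

end

theory Submission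
  imports Defs "HOL-Real_Asymp.Real_Asymp"
begin

text \<open>Identify the plane with the complex numbers, the centre being \<open>0\<close>. The Levi-Civita substitution
  \<open>q = z\<^sup>2\<close>, \<open>dt = |z|\<^sup>2 ds\<close> turns Kepler motion of energy \<open>E\<close> into the linear equation \<open>z'' = (E / 2) z\<close> with
  \<open>2 |z'|\<^sup>2 - E |z|\<^sup>2 = 1\<close>, collisions included. An arc from \<open>a\<^sup>2\<close> to \<open>c\<^sup>2\<close> lifts to a curve from \<open>a\<close> to
  \<open>c\<close> or to \<open>- c\<close>, and it is simple iff the lift is shorter than half a period. Each of the two targets
  gives exactly one arc: about the midpoint of the parameter interval \<open>[-h, h]\<close> the lift reads
  \<open>P C(s) / C(h) + Q S(s) / S(h)\<close> with \<open>P\<close>, \<open>Q\<close> the half sum and half difference of the endpoints and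
  \<open>C\<close>, \<open>S\<close> the even and odd fundamental solutions. In terms of \<open>k = - E h\<^sup>2 / 2 < (\<pi> / 2)\<^sup>2\<close>, the length
  \<open>h\<close> and, by Sturm comparison, the normalised profiles \<open>C(s)\<^sup>2 / C(h)\<^sup>2\<close> and \<open>S(s)\<^sup>2 / S(h)\<^sup>2\<close> all
  increase with \<open>k\<close>; hence so does the flight time \<open>\<integral> |z|\<^sup>2 ds\<close>, which runs through all positive values.\<close>

section \<open>Stumpff functions\<close>

text \<open>Two points need more than monotonicity. An arc determines its lift only up to sign, and
  uniqueness for the Kepler equation breaks down at a collision, so a square root of an arbitrary
  arc is never followed continuously. The lift is instead computed from the initial data alone, and
  its square is compared with \<open>q\<close> through a linear system that stays regular at
  collisions. The midpoint of the parameter interval is used because parity separates the two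
  boundary conditions there and cancels the mixed term in the flight time: only the norms of
  \<open>P\<close> and \<open>Q\<close> survive, and one scalar unknown is left. The bound
  \<open>(pi / 2)^2\<close> is exactly what keeps both profiles positive up to the end of the half
  interval. For very negative \<open>k\<close> the expression that should be a squared length can be
  negative, so that no orbit exists; strict monotonicity is claimed only from where it is positive,
  while the intermediate value argument may cross the other region.\<close>

definition stumpff0 :: "real \<Rightarrow> real" where
  "stumpff0 x = (if x \<ge> 0 then cos (sqrt x) else cosh (sqrt (- x)))"

definition stumpff1 :: "real \<Rightarrow> real" where
  "stumpff1 x = (if x > 0 then sin (sqrt x) / sqrt x
     else if x = 0 then 1 else sinh (sqrt (- x)) / sqrt (- x))"

text \<open>The integral of \<open>(sink x s)^2\<close> over [0, 1] as a function of the parameter.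
  The quotient has a removable singularity at 0, where the integral of \<open>s^2\<close> supplies
  \<open>1 / 3\<close>.\<close>

definition stumpffU :: "real \<Rightarrow> real" where
  "stumpffU x = (if x = 0 then 1 / 3 else (1 - stumpff0 x * stumpff1 x) / (2 * x))"

text \<open>The fundamental solutions of \<open>z'' = - k z\<close>. Going through the entire functions above keeps them
  continuous in \<open>k\<close> across the parabolic value \<open>k = 0\<close>.\<close>

definition cosk :: "real \<Rightarrow> real \<Rightarrow> real" where "cosk k s = stumpff0 (k * s\<^sup>2)"
definition sink :: "real \<Rightarrow> real \<Rightarrow> real" where "sink k s = s * stumpff1 (k * s\<^sup>2)"
definition sink_sq_int :: "real \<Rightarrow> real \<Rightarrow> real" where "sink_sq_int k s = s ^ 3 * stumpffU (k * s\<^sup>2)"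

lemma cosk_pos_eq: "k > 0 \<Longrightarrow> cosk k s = cos (sqrt k * s)"
  by (simp add: cosk_def stumpff0_def real_sqrt_mult abs_if)

lemma cosk_neg_eq: "k < 0 \<Longrightarrow> cosk k s = cosh (sqrt (- k) * s)"
proof (cases "s = 0")
  case False
  assume "k < 0"
  then have "k * s\<^sup>2 < 0" using False by (simp add: mult_neg_pos)
  moreover have "sqrt (- (k * s\<^sup>2)) = sqrt (-k) * \<bar>s\<bar>"
    by (metis mult_minus_left real_sqrt_abs real_sqrt_mult)
  ultimately show ?thesis by (auto simp add: cosk_def stumpff0_def abs_if)
qed (simp add: cosk_def stumpff0_def)

lemma cosk_0_eq [simp]: "cosk 0 s = 1"
  by (simp add: cosk_def stumpff0_def)

lemma sink_pos_eq: "k > 0 \<Longrightarrow> sink k s = sin (sqrt k * s) / sqrt k"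
  by (simp add: sink_def stumpff1_def real_sqrt_mult abs_if)

lemma sink_neg_eq: "k < 0 \<Longrightarrow> sink k s = sinh (sqrt (- k) * s) / sqrt (- k)"
proof (cases "s = 0")
  case False
  assume "k < 0"
  then have "k * s\<^sup>2 < 0" using False by (simp add: mult_neg_pos)
  moreover have "sqrt (- (k * s\<^sup>2)) = sqrt (-k) * \<bar>s\<bar>"
    by (metis mult_minus_left real_sqrt_abs real_sqrt_mult)
  ultimately show ?thesis using False by (auto simp add: sink_def stumpff1_def abs_if)
qed (simp add: sink_def)

lemma sink_0_eq [simp]: "sink 0 s = s"
  by (simp add: sink_def stumpff1_def)

lemma cosk_zero [simp]: "cosk k 0 = 1" and sink_zero [simp]: "sink k 0 = 0"
  by (simp_all add: cosk_def sink_def stumpff0_def)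

lemma has_real_derivative_cosk [derivative_intros]:
  "(cosk k has_real_derivative - k * sink k s) (at s within X)"
proof -
  consider "k > 0" | "k = 0" | "k < 0" by linarith
  then show ?thesis
  proof cases
    case 1
    then have "cosk k = (\<lambda>s. cos (sqrt k * s))" by (auto simp: cosk_pos_eq)
    then show ?thesis using 1
      by (auto intro!: derivative_eq_intros simp: sink_pos_eq field_simps)
  next
    case 2
    then have "cosk k = (\<lambda>s. 1)" by auto
    then show ?thesis using 2 by auto
  next
    case 3
    then have eq: "cosk k = (\<lambda>s. cosh (sqrt (- k) * s))" by (auto simp: cosk_neg_eq)
    define r where "r = sqrt (- k)"
    have r: "r > 0" "k = - r * r" using 3 by (simp_all add: r_def)
    show ?thesis unfolding eq sink_neg_eq[OF 3] using r(1)
      by (auto simp flip: r_def simp: r(2) intro!: derivative_eq_intros)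
  qed
qed

lemma has_real_derivative_sink [derivative_intros]:
  "(sink k has_real_derivative cosk k s) (at s within X)"
proof -
  consider "k > 0" | "k = 0" | "k < 0" by linarith
  then show ?thesis
  proof cases
    case 1
    then have "sink k = (\<lambda>s. sin (sqrt k * s) / sqrt k)" by (auto simp: sink_pos_eq)
    then show ?thesis using 1
      by (auto intro!: derivative_eq_intros simp: cosk_pos_eq field_simps)
  next
    case 2
    then have "sink k = (\<lambda>s. s)" by auto
    then show ?thesis using 2 by (auto intro!: derivative_eq_intros)
  next
    case 3
    then have eq: "sink k = (\<lambda>s. sinh (sqrt (- k) * s) / sqrt (- k))" by (auto simp: sink_neg_eq)
    define r where "r = sqrt (- k)"
    have r: "r > 0" "k = - r * r" using 3 by (simp_all add: r_def)
    show ?thesis unfolding eq cosk_neg_eq[OF 3] r_def[symmetric] using r(1)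
      by (auto intro!: derivative_eq_intros)
  qed
qed

lemma cosk_sink_squares: "(cosk k s)\<^sup>2 + k * (sink k s)\<^sup>2 = 1"
proof -
  consider "k > 0" | "k = 0" | "k < 0" by linarith
  then show ?thesis
  proof cases
    case 3
    then show ?thesis
      by (simp add: cosk_neg_eq sink_neg_eq power_divide cosh_square_eq)
  qed (simp_all add: cosk_pos_eq sink_pos_eq power_divide)
qed

lemma cosk_add: "cosk k (s + t) = cosk k s * cosk k t - k * sink k s * sink k t"
proof -
  consider "k > 0" | "k = 0" | "k < 0" by linarith
  then show ?thesis
    by cases (auto simp: cosk_pos_eq sink_pos_eq cosk_neg_eq sink_neg_eq distrib_left cos_add cosh_add)
qed

lemma sink_add: "sink k (s + t) = sink k s * cosk k t + cosk k s * sink k t"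
proof -
  consider "k > 0" | "k = 0" | "k < 0" by linarith
  then show ?thesis
    by cases (auto simp: cosk_pos_eq sink_pos_eq cosk_neg_eq sink_neg_eq distrib_left sin_add sinh_add add_divide_distrib)
qed

lemma cosk_minus [simp]: "cosk k (- s) = cosk k s" and sink_minus [simp]: "sink k (- s) = - sink k s"
  by (simp_all add: cosk_def sink_def)

lemma sink_positive:
  assumes "0 < s" "k * s\<^sup>2 < pi\<^sup>2" shows "0 < sink k s"
proof -
  consider "k > 0" | "k = 0" | "k < 0" by linarith
  then show ?thesis
  proof cases
    case 1
    have "(sqrt k * s)\<^sup>2 < pi\<^sup>2" using 1 assms by (simp add: power_mult_distrib)
    then have "sqrt k * s < pi" using power2_less_imp_less pi_ge_zero by blast
    then show ?thesis using 1 assms by (simp add: sink_pos_eq sin_gt_zero)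
  qed (use assms in \<open>simp_all add: sink_neg_eq\<close>)
qed

lemma cosk_positive:
  assumes "k * s\<^sup>2 < (pi / 2)\<^sup>2" shows "0 < cosk k s"
proof -
  consider "k > 0" | "k = 0" | "k < 0" by linarith
  then show ?thesis
  proof cases
    case 1
    have "(sqrt k * \<bar>s\<bar>)\<^sup>2 < (pi/2)\<^sup>2" using 1 assms by (simp add: power_mult_distrib)
    then have "sqrt k * \<bar>s\<bar> < pi/2" by (rule power2_less_imp_less) simp
    then have "0 < cos (sqrt k * \<bar>s\<bar>)" using 1
      by (intro cos_gt_zero_pi) (auto intro: less_le_trans[of _ 0])
    then show ?thesis using 1 by (auto simp: cosk_pos_eq abs_if split: if_splits)
  qed (use assms in \<open>simp_all add: cosk_neg_eq cosh_real_pos\<close>)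
qed

lemma has_real_derivative_sink_sq_int [derivative_intros]:
  "(sink_sq_int k has_real_derivative (sink k s)\<^sup>2) (at s within X)"
proof (cases "k = 0")
  case True
  then have "sink_sq_int k = (\<lambda>s. s ^ 3 / 3)" by (auto simp: sink_sq_int_def stumpffU_def)
  then show ?thesis using True by (auto intro!: derivative_eq_intros)
next
  case False
  have "sink_sq_int k = (\<lambda>s. (s - cosk k s * sink k s) / (2 * k))"
    using False by (auto simp: sink_sq_int_def stumpffU_def cosk_def sink_def field_simps power2_eq_square power3_eq_cube)
  moreover have "((\<lambda>s. (s - cosk k s * sink k s) / (2 * k)) has_real_derivative
      (1 - (- k * sink k s * sink k s + cosk k s * cosk k s)) / (2 * k)) (at s within X)"
    using False by (auto intro!: derivative_eq_intros) (simp add: field_simps)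
  moreover have "(1 - (- k * sink k s * sink k s + cosk k s * cosk k s)) = 2 * k * (sink k s)\<^sup>2"
    using cosk_sink_squares[of k s] by (simp add: power2_eq_square algebra_simps)
  ultimately show ?thesis using False by simp
qed

lemma sink_sq_int_zero [simp]: "sink_sq_int k 0 = 0" by (simp add: sink_sq_int_def)

section \<open>Continuity in the parameter, across the parabolic value\<close>

lemma isCont_0_piecewise:
  fixes f g h :: "real \<Rightarrow> real"
  assumes "(g \<longlongrightarrow> f 0) (at_left 0)" "(h \<longlongrightarrow> f 0) (at_right 0)"
    "\<And>x. x < 0 \<Longrightarrow> f x = g x" "\<And>x. x > 0 \<Longrightarrow> f x = h x"
  shows "isCont f 0"
proof -
  have "(f \<longlongrightarrow> f 0) (at_left 0)"
    by (rule tendsto_cong[THEN iffD1, OF _ assms(1)]) (auto simp: eventually_at_filter assms(3))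
  moreover have "(f \<longlongrightarrow> f 0) (at_right 0)"
    by (rule tendsto_cong[THEN iffD1, OF _ assms(2)]) (auto simp: eventually_at_filter assms(4))
  ultimately show ?thesis by (simp add: isCont_def filterlim_at_split)
qed

lemma isCont_piecewise:
  fixes f g h :: "real \<Rightarrow> real"
  assumes "(g \<longlongrightarrow> f 0) (at_left 0)" "(h \<longlongrightarrow> f 0) (at_right 0)"
    and g: "\<And>x. x < 0 \<Longrightarrow> f x = g x" "\<And>x. x < 0 \<Longrightarrow> isCont g x"
    and h: "\<And>x. x > 0 \<Longrightarrow> f x = h x" "\<And>x. x > 0 \<Longrightarrow> isCont h x"
  shows "isCont f x"
proof -
  consider "x > 0" | "x = 0" | "x < 0" by linarith
  then show ?thesis
  proof cases
    case 1
    have "\<forall>\<^sub>F y in nhds x. f y = h y"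
      using eventually_nhds_in_open[of "{0<..}" x] 1 by (auto elim!: eventually_mono simp: h)
    then show ?thesis using h(2)[OF 1] isCont_cong by blast
  next
    case 2 then show ?thesis using isCont_0_piecewise[OF assms(1,2) g(1) h(1)] by simp
  next
    case 3
    have "\<forall>\<^sub>F y in nhds x. f y = g y"
      using eventually_nhds_in_open[of "{..<0}" x] 3 by (auto elim!: eventually_mono simp: g)
    then show ?thesis using g(2)[OF 3] isCont_cong by blast
  qed
qed

lemma isCont_stumpff0: "isCont stumpff0 x"
proof (rule isCont_piecewise[where g = "\<lambda>x. cosh (sqrt (- x))" and h = "\<lambda>x. cos (sqrt x)"])
  show "((\<lambda>x. cosh (sqrt (- x))) \<longlongrightarrow> stumpff0 0) (at_left 0)"
    unfolding stumpff0_def by (auto intro!: tendsto_eq_intros)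
  show "((\<lambda>x. cos (sqrt x)) \<longlongrightarrow> stumpff0 0) (at_right 0)"
    unfolding stumpff0_def by (auto intro!: tendsto_eq_intros)
qed (auto simp: stumpff0_def intro!: continuous_intros)

lemma isCont_stumpff1: "isCont stumpff1 x"
proof (rule isCont_piecewise[where g = "\<lambda>x. sinh (sqrt (- x)) / sqrt (- x)" and h = "\<lambda>x. sin (sqrt x) / sqrt x"])
  show "((\<lambda>x. sinh (sqrt (- x)) / sqrt (- x)) \<longlongrightarrow> stumpff1 0) (at_left 0)"
    unfolding stumpff1_def by simp real_asymp
  show "((\<lambda>x. sin (sqrt x) / sqrt x) \<longlongrightarrow> stumpff1 0) (at_right 0)"
    unfolding stumpff1_def by simp real_asymp
qed (auto simp: stumpff1_def intro!: continuous_intros)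

lemma isCont_stumpffU: "isCont stumpffU x"
proof (rule isCont_piecewise[where g = "\<lambda>x. (1 - cosh (sqrt (- x)) * (sinh (sqrt (- x)) / sqrt (- x))) / (2 * x)"
    and h = "\<lambda>x. (1 - cos (sqrt x) * (sin (sqrt x) / sqrt x)) / (2 * x)"])
  show "((\<lambda>x. (1 - cosh (sqrt (- x)) * (sinh (sqrt (- x)) / sqrt (- x))) / (2 * x)) \<longlongrightarrow> stumpffU 0) (at_left 0)"
    unfolding stumpffU_def by simp real_asymp
  show "((\<lambda>x. (1 - cos (sqrt x) * (sin (sqrt x) / sqrt x)) / (2 * x)) \<longlongrightarrow> stumpffU 0) (at_right 0)"
    unfolding stumpffU_def by simp real_asymp
qed (auto simp: stumpffU_def stumpff0_def stumpff1_def intro!: continuous_intros)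

lemma cosk_one: "cosk k 1 = stumpff0 k" and sink_one: "sink k 1 = stumpff1 k" and sink_sq_int_one: "sink_sq_int k 1 = stumpffU k"
  by (simp_all add: cosk_def sink_def sink_sq_int_def)

text \<open>\<open>C^2 + k S^2 = 1\<close> and \<open>C^2 - k S^2 = (C S)'\<close> give this
  primitive of \<open>C^2\<close> at once. No division by \<open>k\<close> occurs, in contrast to
  the primitive of \<open>S^2\<close>, which is why only the latter passes through a Stumpff
  function of its own.\<close>

definition cosk_sq_int :: "real \<Rightarrow> real \<Rightarrow> real" where "cosk_sq_int k s = (s + cosk k s * sink k s) / 2"

lemma cosk_sq_int_zero [simp]: "cosk_sq_int k 0 = 0" by (simp add: cosk_sq_int_def)

lemma has_real_derivative_cosk_sq_int [derivative_intros]: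
  "(cosk_sq_int k has_real_derivative (cosk k s)\<^sup>2) (at s within X)"
proof -
  have "((\<lambda>s. (s + cosk k s * sink k s) / 2) has_real_derivative
      (1 + (- k * sink k s * sink k s + cosk k s * cosk k s)) / 2) (at s within X)"
    by (auto intro!: derivative_eq_intros)
  moreover have "(1 + (- k * sink k s * sink k s + cosk k s * cosk k s)) / 2 = (cosk k s)\<^sup>2"
    using cosk_sink_squares[of k s] by (simp add: power2_eq_square algebra_simps)
  moreover have "(\<lambda>s. (s + cosk k s * sink k s) / 2) = cosk_sq_int k" by (auto simp: cosk_sq_int_def)
  ultimately show ?thesis by simp
qed

section \<open>Sturm comparison of the profiles\<close>

text \<open>The Wronskian \<open>g' f - g f'\<close> vanishes at 0 and has derivative
  \<open>(k - l) f g < 0\<close>, so it is negative afterwards; divided by \<open>f^2\<close> it is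
  the derivative of the quotient. Positivity is asked only away from 0, together with
  \<open>0 < f x\<close>: this admits the even profiles from time 0 on and the odd ones, which
  vanish at 0, from any later time.\<close>

lemma sturm_quotient_decreasing:
  fixes f g f' g' :: "real \<Rightarrow> real"
  assumes f: "\<And>t. (f has_real_derivative f' t) (at t)" "\<And>t. (f' has_real_derivative - k * f t) (at t)"
    and g: "\<And>t. (g has_real_derivative g' t) (at t)" "\<And>t. (g' has_real_derivative - l * g t) (at t)"
    and "k < l" "g' 0 * f 0 = g 0 * f' 0" "0 \<le> x" "x < y"
    and pos: "\<And>t. 0 < t \<Longrightarrow> t \<le> y \<Longrightarrow> 0 < f t" "\<And>t. 0 < t \<Longrightarrow> t \<le> y \<Longrightarrow> 0 < g t"
    and "0 < f x"
  shows "g y / f y < g x / f x"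
proof (rule DERIV_neg_imp_decreasing_open[where f = "\<lambda>t. g t / f t", OF \<open>x < y\<close>])
  define W where "W = (\<lambda>t. g' t * f t - g t * f' t)"
  have dW: "(W has_real_derivative (k - l) * (f t * g t)) (at t)" for t
    unfolding W_def by (auto intro!: derivative_eq_intros f g simp: algebra_simps)
  fix t assume t: "x < t" "t < y"
  have "W t < W 0"
  proof (rule DERIV_neg_imp_decreasing_open[where f = W])
    show "0 < t" using t assms by linarith
    show "continuous_on {0..t} W"
      by (intro continuous_at_imp_continuous_on ballI DERIV_isCont[OF dW])
    fix u assume "0 < u" "u < t"
    then show "\<exists>D. DERIV W u :> D \<and> D < 0"
      using dW[of u] pos[of u] t \<open>k < l\<close> by (auto intro!: mult_neg_pos)
  qed
  then have "W t < 0" using assms by (simp add: W_def)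
  have "f t > 0" using pos(1)[of t] t assms by auto
  have "((\<lambda>t. g t / f t) has_real_derivative (g' t * f t - g t * f' t) / (f t * f t)) (at t)"
    using \<open>f t > 0\<close> by (auto intro!: derivative_eq_intros f g)
  moreover have "(g' t * f t - g t * f' t) / (f t * f t) < 0"
    using \<open>W t < 0\<close> \<open>f t > 0\<close> by (simp add: W_def divide_neg_pos)
  ultimately show "\<exists>D. DERIV (\<lambda>t. g t / f t) t :> D \<and> D < 0" by blast
next
  have "continuous_on {x..y} f" "continuous_on {x..y} g"
    by (intro continuous_at_imp_continuous_on ballI DERIV_isCont[OF f(1)] DERIV_isCont[OF g(1)])+
  moreover have "f t \<noteq> 0" if "t \<in> {x..y}" for t
    using that pos(1)[of t] \<open>0 < f x\<close> \<open>0 \<le> x\<close> by (cases "t = x") force+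
  ultimately show "continuous_on {x..y} (\<lambda>t. g t / f t)"
    by (auto intro!: continuous_intros)
qed

text \<open>For \<open>k \<le> 0\<close> the left side is never positive; for \<open>k > 0\<close>
  it grows with the size of \<open>d\<close>. A bound at the end of an interval thus serves all
  shorter spans.\<close>

lemma mult_square_less_mono:
  fixes k :: real
  assumes "k * H\<^sup>2 < c" "0 < c" "\<bar>d\<bar> \<le> H" shows "k * d\<^sup>2 < c"
proof (cases "k \<le> 0")
  case True
  then have "k * d\<^sup>2 \<le> 0" by (simp add: mult_nonpos_nonneg)
  then show ?thesis using assms by linarith
next
  case False
  have "d\<^sup>2 \<le> H\<^sup>2" using assms(3) abs_le_square_iff[of d H] by simp
  then have "k * d\<^sup>2 \<le> k * H\<^sup>2" using False by (simp add: mult_left_mono)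
  then show ?thesis using assms by linarith
qed

lemma cosk_pos_unit: "k < (pi / 2)\<^sup>2 \<Longrightarrow> \<bar>t\<bar> \<le> 1 \<Longrightarrow> 0 < cosk k t"
  by (rule cosk_positive, rule mult_square_less_mono[of k 1]) auto

lemma halfpi_square_less: "(pi / 2)\<^sup>2 < pi\<^sup>2"
  by (simp add: power_divide)

lemma sink_pos_unit: "k < (pi / 2)\<^sup>2 \<Longrightarrow> 0 < t \<Longrightarrow> t \<le> 1 \<Longrightarrow> 0 < sink k t"
  using halfpi_square_less mult_square_less_mono[of k 1 "(pi / 2)\<^sup>2" t] by (intro sink_positive) auto

context
  fixes k l :: real
  assumes kl: "k < l" and l: "l < (pi / 2)\<^sup>2"
begin

lemma cosk_ratio_less:
  assumes "0 \<le> x" "x < y" "y \<le> 1" shows "cosk l y / cosk k y < cosk l x / cosk k x"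
  using assms kl l
  by (intro sturm_quotient_decreasing[where k = k and l = l and f' = "\<lambda>t. - k * sink k t" and g' = "\<lambda>t. - l * sink l t"])
     (use has_real_derivative_cosk DERIV_cmult[OF has_real_derivative_sink] in \<open>auto intro!: cosk_pos_unit DERIV_minus\<close>)

lemma sink_ratio_less:
  assumes "0 < x" "x < y" "y \<le> 1" shows "sink l y / sink k y < sink l x / sink k x"
  using assms kl l
  by (intro sturm_quotient_decreasing[where k = k and l = l and f' = "cosk k" and g' = "cosk l"])
     (use has_real_derivative_cosk has_real_derivative_sink in \<open>auto intro!: sink_pos_unit\<close>)

lemma cosk_strict_antimono: "0 < t \<Longrightarrow> t \<le> 1 \<Longrightarrow> cosk l t < cosk k t"
  using cosk_ratio_less[of 0 t] cosk_pos_unit[of k t] kl l by (simp add: field_simps)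

text \<open>The even profiles are the derivatives of the odd ones, so their pointwise comparison
  integrates from the common value 0.\<close>

lemma sink_antimono: "sink l 1 \<le> sink k 1"
proof -
  have "sink k 0 - sink l 0 \<le> sink k 1 - sink l 1"
  proof (rule DERIV_nonneg_imp_nondecreasing[where f = "\<lambda>t. sink k t - sink l t"])
    fix t :: real assume t: "0 \<le> t" "t \<le> 1"
    have "((\<lambda>t. sink k t - sink l t) has_real_derivative cosk k t - cosk l t) (at t)"
      by (intro derivative_intros)
    moreover have "cosk l t \<le> cosk k t"
      using cosk_strict_antimono[of t] t by (cases "t = 0") auto
    ultimately show "\<exists>y. ((\<lambda>t. sink k t - sink l t) has_real_derivative y) (at t) \<and> 0 \<le> y"
      by (intro exI[of _ "cosk k t - cosk l t"]) simp
  qed simp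
  then show ?thesis by simp
qed

text \<open>The quotient of the \<open>l\<close> profile by the \<open>k\<close> profile falls,
  hence is smallest at time 1. Dividing each profile by its own end value therefore puts the one
  with the larger parameter on top at all earlier times.\<close>

lemma cosk_normalized_mono:
  assumes "0 \<le> t" "t \<le> 1" shows "(cosk k t)\<^sup>2 / (cosk k 1)\<^sup>2 \<le> (cosk l t)\<^sup>2 / (cosk l 1)\<^sup>2"
proof -
  have pos: "0 < cosk k 1" "0 < cosk l 1" "0 < cosk k t" "0 < cosk l t"
    using kl l assms by (auto intro!: cosk_pos_unit)
  have "cosk l 1 / cosk k 1 \<le> cosk l t / cosk k t"
    using cosk_ratio_less[of t 1] assms by (cases "t = 1") auto
  then have "cosk k t / cosk k 1 \<le> cosk l t / cosk l 1" using pos by (simp add: field_simps)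
  then have "(cosk k t / cosk k 1)\<^sup>2 \<le> (cosk l t / cosk l 1)\<^sup>2" using pos by (intro power_mono) auto
  then show ?thesis by (simp add: power_divide)
qed

lemma sink_normalized_mono:
  assumes "0 \<le> t" "t \<le> 1" shows "(sink k t)\<^sup>2 / (sink k 1)\<^sup>2 \<le> (sink l t)\<^sup>2 / (sink l 1)\<^sup>2"
proof (cases "t = 0")
  case False
  then have pos: "0 < sink k 1" "0 < sink l 1" "0 < sink k t" "0 < sink l t"
    using kl l assms by (auto intro!: sink_pos_unit)
  have "sink l 1 / sink k 1 \<le> sink l t / sink k t"
    using sink_ratio_less[of t 1] assms False by (cases "t = 1") auto
  then have "sink k t / sink k 1 \<le> sink l t / sink l 1" using pos by (simp add: field_simps)
  then have "(sink k t / sink k 1)\<^sup>2 \<le> (sink l t / sink l 1)\<^sup>2" using pos by (intro power_mono) auto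
  then show ?thesis by (simp add: power_divide)
qed simp

lemma cosk_sq_int_normalized_mono: "cosk_sq_int k 1 / (cosk k 1)\<^sup>2 \<le> cosk_sq_int l 1 / (cosk l 1)\<^sup>2"
proof -
  let ?D = "\<lambda>t. cosk_sq_int l t / (cosk l 1)\<^sup>2 - cosk_sq_int k t / (cosk k 1)\<^sup>2"
  have "?D 0 \<le> ?D 1"
  proof (rule DERIV_nonneg_imp_nondecreasing[where f = ?D])
    fix t :: real assume t: "0 \<le> t" "t \<le> 1"
    have "(?D has_real_derivative (cosk l t)\<^sup>2 / (cosk l 1)\<^sup>2 - (cosk k t)\<^sup>2 / (cosk k 1)\<^sup>2) (at t)"
      by (intro derivative_intros DERIV_cdivide)
    then show "\<exists>y. (?D has_real_derivative y) (at t) \<and> 0 \<le> y"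
      using cosk_normalized_mono[OF t] by fastforce
  qed simp
  then show ?thesis by simp
qed

lemma sink_sq_int_normalized_mono: "sink_sq_int k 1 / (sink k 1)\<^sup>2 \<le> sink_sq_int l 1 / (sink l 1)\<^sup>2"
proof -
  let ?D = "\<lambda>t. sink_sq_int l t / (sink l 1)\<^sup>2 - sink_sq_int k t / (sink k 1)\<^sup>2"
  have "?D 0 \<le> ?D 1"
  proof (rule DERIV_nonneg_imp_nondecreasing[where f = ?D])
    fix t :: real assume t: "0 \<le> t" "t \<le> 1"
    have "(?D has_real_derivative (sink l t)\<^sup>2 / (sink l 1)\<^sup>2 - (sink k t)\<^sup>2 / (sink k 1)\<^sup>2) (at t)"
      by (intro derivative_intros DERIV_cdivide)
    then show "\<exists>y. (?D has_real_derivative y) (at t) \<and> 0 \<le> y"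
      using sink_normalized_mono[OF t] by fastforce
  qed simp
  then show ?thesis by simp
qed

end

lemma sink_sq_int_one_nonneg: "0 \<le> sink_sq_int k 1"
proof -
  have "sink_sq_int k 0 \<le> sink_sq_int k 1"
    by (rule DERIV_nonneg_imp_nondecreasing[where f = "sink_sq_int k"])
      (auto intro!: exI[of _ "(sink k _)\<^sup>2"] has_real_derivative_sink_sq_int)
  then show ?thesis by simp
qed

section \<open>The flight time as a function of the energy parameter\<close>

text \<open>Here \<open>p\<close> and \<open>q\<close> are the squared norms of the half sum and half difference of the endpoints of
  a lifted arc, and \<open>k\<close> is \<open>- E / 2\<close> times the squared half length of its parameter interval, the
  latter being forced to equal \<open>half_span_sq p q k\<close> by the energy normalisation.\<close>

definition half_span_sq :: "real \<Rightarrow> real \<Rightarrow> real \<Rightarrow> real" where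
  "half_span_sq p q k = 2 * (q - p + p / (cosk k 1)\<^sup>2) / (sink k 1)\<^sup>2"

definition mean_radius :: "real \<Rightarrow> real \<Rightarrow> real \<Rightarrow> real" where
  "mean_radius p q k = p * (cosk_sq_int k 1 / (cosk k 1)\<^sup>2) + q * (sink_sq_int k 1 / (sink k 1)\<^sup>2)"

definition flight_time :: "real \<Rightarrow> real \<Rightarrow> real \<Rightarrow> real" where
  "flight_time p q k = 2 * sqrt (half_span_sq p q k) * mean_radius p q k"

text \<open>This is the form that the energy relation at the midpoint produces. The defining form
  comes from it by eliminating \<open>k\<close> with \<open>C^2 + k S^2 = 1\<close>, so that
  monotonicity can be read off from \<open>C\<close> and \<open>S\<close> without discussing the
  sign of \<open>k\<close>.\<close>

lemma half_span_sq_eq: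
  assumes "k < (pi / 2)\<^sup>2"
  shows "half_span_sq p q k = 2 * (k * p / (cosk k 1)\<^sup>2 + q / (sink k 1)\<^sup>2)"
proof -
  have "cosk k 1 > 0" "sink k 1 > 0" using assms by (auto intro: cosk_pos_unit sink_pos_unit)
  moreover have "p = p * (cosk k 1)\<^sup>2 + p * (k * (sink k 1)\<^sup>2)"
    using cosk_sink_squares[of k 1] by (metis distrib_left mult.right_neutral)
  ultimately show ?thesis by (simp add: half_span_sq_def field_simps)
qed

text \<open>The numerator increases and the denominator does not. Positivity at \<open>k\<close> is
  what lets the two effects combine: a negative numerator would be pushed down by a shrinking
  denominator.\<close>

lemma half_span_sq_strict_mono:
  assumes "0 < p" "k < l" "l < (pi / 2)\<^sup>2" "0 < half_span_sq p q k"
  shows "half_span_sq p q k < half_span_sq p q l"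
proof -
  have pos: "0 < cosk k 1" "0 < cosk l 1" "0 < sink k 1" "0 < sink l 1"
    using assms by (auto intro!: cosk_pos_unit sink_pos_unit)
  let ?n = "\<lambda>k. q - p + p / (cosk k 1)\<^sup>2"
  have "(cosk l 1)\<^sup>2 < (cosk k 1)\<^sup>2"
    using cosk_strict_antimono[of k l 1] assms pos by (intro power_strict_mono) auto
  then have n: "?n k < ?n l" using assms pos by (simp add: frac_less2)
  have "0 < ?n k" using assms(4) pos by (simp add: half_span_sq_def zero_less_divide_iff zero_less_mult_iff)
  moreover have "(sink l 1)\<^sup>2 \<le> (sink k 1)\<^sup>2"
    using sink_antimono[of k l] assms pos by (intro power_mono) auto
  ultimately have "?n k / (sink k 1)\<^sup>2 < ?n l / (sink l 1)\<^sup>2" using n pos by (intro frac_less) auto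
  then have "2 * (?n k / (sink k 1)\<^sup>2) < 2 * (?n l / (sink l 1)\<^sup>2)" by (rule mult_strict_left_mono) simp
  then show ?thesis unfolding half_span_sq_def times_divide_eq_right .
qed

lemma mean_radius_mono:
  assumes "0 < p" "0 < q" "k < l" "l < (pi / 2)\<^sup>2"
  shows "mean_radius p q k \<le> mean_radius p q l"
  unfolding mean_radius_def using assms
  by (intro add_mono mult_left_mono cosk_sq_int_normalized_mono sink_sq_int_normalized_mono) auto

lemma mean_radius_pos:
  assumes "0 < p" "0 < q" "k < (pi / 2)\<^sup>2"
  shows "0 < mean_radius p q k"
proof -
  have "0 < sink k 1" "0 < cosk k 1" using assms by (auto intro: cosk_pos_unit sink_pos_unit)
  then have "0 < cosk_sq_int k 1" by (simp add: cosk_sq_int_def add_pos_pos)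
  then show ?thesis unfolding mean_radius_def
    using assms sink_sq_int_one_nonneg[of k] \<open>0 < cosk k 1\<close> by (intro add_pos_nonneg) auto
qed

lemma flight_time_strict_mono:
  assumes "0 < p" "0 < q" "k < l" "l < (pi / 2)\<^sup>2" "0 < half_span_sq p q k"
  shows "flight_time p q k < flight_time p q l"
proof -
  have "sqrt (half_span_sq p q k) < sqrt (half_span_sq p q l)"
    using half_span_sq_strict_mono assms by simp
  moreover have "0 < sqrt (half_span_sq p q k)" using assms by simp
  moreover have "0 < mean_radius p q k" using assms by (intro mean_radius_pos) auto
  ultimately have "sqrt (half_span_sq p q k) * mean_radius p q k < sqrt (half_span_sq p q l) * mean_radius p q l"
    using mean_radius_mono[of p q k l] assms by (intro mult_less_le_imp_less) auto
  then show ?thesis by (simp add: flight_time_def)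
qed

lemma continuous_on_flight_time:
  assumes "\<And>k. k \<in> X \<Longrightarrow> k < (pi / 2)\<^sup>2"
  shows "continuous_on X (flight_time p q)"
proof -
  have c: "continuous_on X (\<lambda>k. cosk k 1)" "continuous_on X (\<lambda>k. sink k 1)" "continuous_on X (\<lambda>k. sink_sq_int k 1)"
    unfolding cosk_one sink_one sink_sq_int_one
    by (auto intro!: continuous_at_imp_continuous_on isCont_stumpff0 isCont_stumpff1 isCont_stumpffU)
  have "cosk k 1 \<noteq> 0 \<and> sink k 1 \<noteq> 0" if "k \<in> X" for k
    using cosk_pos_unit[of k 1] sink_pos_unit[of k 1] assms[OF that] by auto
  then show ?thesis
    unfolding flight_time_def half_span_sq_def mean_radius_def cosk_sq_int_def
    by (intro continuous_intros c) auto
qed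

text \<open>As \<open>k\<close> tends to minus infinity, \<open>sink k 1\<close> grows without bound
  and the half length is at most \<open>sqrt (2 * q) / sink k 1\<close>, while the mean radius stays
  below its parabolic value \<open>p + q / 3\<close>. Where \<open>half_span_sq\<close> is negative,
  \<open>sqrt\<close> is negative as well and the estimate still holds.\<close>

lemma flight_time_small:
  assumes "0 < p" "0 < q" "0 < T"
  shows "\<exists>k<0. flight_time p q k < T"
proof -
  have "filterlim (\<lambda>r::real. sinh r / r) at_top at_top" by real_asymp
  \<comment> \<open>The threshold is \<open>2 * (sqrt (2 * q) / S) * (p + q / 3) < T\<close> solved
    for \<open>S = sinh r / r\<close>.\<close>
  then have "eventually (\<lambda>r::real. sinh r / r > 2 * sqrt (2 * q) * (p + q / 3) / T) at_top"
    by (simp add: filterlim_at_top_dense)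
  moreover have "eventually (\<lambda>r::real. r > 0) at_top" by (rule eventually_gt_at_top)
  ultimately have "eventually (\<lambda>r::real. sinh r / r > 2 * sqrt (2 * q) * (p + q / 3) / T \<and> r > 0) at_top"
    by (rule eventually_conj)
  then obtain r :: real where r: "r > 0" "sinh r / r > 2 * sqrt (2 * q) * (p + q / 3) / T"
    unfolding eventually_at_top_linorder by blast
  let ?k = "- r\<^sup>2"
  have k: "?k < 0" using r by simp
  have kp: "?k < (pi / 2)\<^sup>2" using k by (smt (verit) zero_le_power2)
  have s: "sink ?k 1 = sinh r / r" using r by (simp add: sink_neg_eq)
  have spos: "0 < sink ?k 1" using kp by (auto intro: sink_pos_unit)
  have "cosk ?k 1 \<ge> 1" using k by (simp add: cosk_neg_eq cosh_real_ge_1)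
  then have "p / (cosk ?k 1)\<^sup>2 \<le> p" using assms by (simp add: divide_le_eq mult_le_cancel_left1)
  then have "half_span_sq p q ?k \<le> 2 * q / (sink ?k 1)\<^sup>2"
    unfolding half_span_sq_def by (intro divide_right_mono) auto
  then have "sqrt (half_span_sq p q ?k) \<le> sqrt (2 * q / (sink ?k 1)\<^sup>2)" by simp
  then have h: "sqrt (half_span_sq p q ?k) \<le> sqrt (2 * q) / sink ?k 1"
    using spos by (simp add: real_sqrt_divide)
  have "mean_radius p q ?k \<le> mean_radius p q 0" using assms k by (intro mean_radius_mono) auto
  also have "\<dots> = p + q / 3" by (simp add: mean_radius_def cosk_sq_int_def sink_sq_int_one stumpffU_def)
  finally have m: "mean_radius p q ?k \<le> p + q / 3" .
  have "flight_time p q ?k \<le> 2 * (sqrt (2 * q) / sink ?k 1) * (p + q / 3)"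
  proof -
    have "sqrt (half_span_sq p q ?k) * mean_radius p q ?k \<le> (sqrt (2 * q) / sink ?k 1) * mean_radius p q ?k"
      using h mean_radius_pos[OF assms(1,2) kp] by (intro mult_right_mono) auto
    also have "\<dots> \<le> (sqrt (2 * q) / sink ?k 1) * (p + q / 3)"
      using m spos assms by (intro mult_left_mono) auto
    finally show ?thesis by (simp add: flight_time_def)
  qed
  also have "\<dots> < T" using r(2) spos assms by (simp add: s[symmetric] field_simps)
  finally show ?thesis using k by blast
qed

text \<open>As \<open>k\<close> approaches \<open>(pi / 2)^2\<close>, \<open>cosk k 1\<close> tends
  to 0 and the half length is at least \<open>sqrt (2 * p) / cosk k 1\<close>, while the mean radius
  stays above \<open>p\<close>.\<close>

lemma flight_time_large:
  assumes "0 < p" "0 < q"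
  shows "\<exists>k. 0 < k \<and> k < (pi / 2)\<^sup>2 \<and> T < flight_time p q k"
proof -
  \<comment> \<open>Chosen so that \<open>cos x < e\<close> turns the lower bound
    \<open>2 * p * sqrt (2 * p) / cos x\<close> into more than
    \<open>\<bar>T\<bar> + 1\<close>.\<close>
  define e where "e = 2 * p * sqrt (2 * p) / (\<bar>T\<bar> + 1)"
  have e: "0 < e" using assms by (simp add: e_def)
  define x where "x = max 1 (pi / 2 - e / 2)"
  have x: "1 \<le> x" "x < pi / 2" using e pi_gt3 by (auto simp: x_def max_def)
  have "cos x = sin (pi / 2 - x)" by (simp add: sin_diff)
  also have "\<dots> \<le> pi / 2 - x" using x by (intro sin_x_le_x) auto
  also have "\<dots> < e" using e by (auto simp: x_def)
  finally have ce: "cos x < e" .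
  let ?k = "x\<^sup>2"
  have k: "?k \<ge> 1" "?k < (pi / 2)\<^sup>2" using x by (auto intro!: power_strict_mono simp: one_le_power)
  have c: "cosk ?k 1 = cos x" using x by (simp add: cosk_pos_eq)
  have cp: "cos x > 0" using cosk_pos_unit[OF k(2), of 1] c by simp
  have "2 * p / (cos x)\<^sup>2 \<le> 2 * (?k * p / (cos x)\<^sup>2 + q / (sink ?k 1)\<^sup>2)"
  proof -
    have "p / (cos x)\<^sup>2 \<le> ?k * p / (cos x)\<^sup>2"
      using k assms by (intro divide_right_mono) auto
    moreover have "0 \<le> q / (sink ?k 1)\<^sup>2" using assms by simp
    ultimately show ?thesis by simp
  qed
  then have "2 * p / (cos x)\<^sup>2 \<le> half_span_sq p q ?k"
    by (simp add: half_span_sq_eq[OF k(2)] c)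
  then have "sqrt (2 * p / (cos x)\<^sup>2) \<le> sqrt (half_span_sq p q ?k)" by simp
  then have h: "sqrt (2 * p) / cos x \<le> sqrt (half_span_sq p q ?k)"
    using cp by (simp add: real_sqrt_divide)
  have "p \<le> mean_radius p q 0" using assms by (simp add: mean_radius_def cosk_sq_int_def sink_sq_int_one stumpffU_def)
  also have "\<dots> \<le> mean_radius p q ?k" using assms k by (intro mean_radius_mono) auto
  finally have m: "p \<le> mean_radius p q ?k" .
  have "T < 2 * (sqrt (2 * p) / cos x) * p"
  proof -
    have "(\<bar>T\<bar> + 1) * cos x < (\<bar>T\<bar> + 1) * e" using ce by (intro mult_strict_left_mono) auto
    also have "\<dots> = 2 * p * sqrt (2 * p)" by (simp add: e_def)
    finally have "\<bar>T\<bar> + 1 < 2 * p * sqrt (2 * p) / cos x" using cp by (simp add: field_simps)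
    then show ?thesis by (simp add: field_simps)
  qed
  also have "\<dots> \<le> flight_time p q ?k"
  proof -
    have "0 < sqrt (half_span_sq p q ?k)"
      using h cp assms by (intro less_le_trans[OF _ h]) simp
    then have "(sqrt (2 * p) / cos x) * p \<le> sqrt (half_span_sq p q ?k) * mean_radius p q ?k"
      using h m cp assms by (intro mult_mono) auto
    then show ?thesis by (simp add: flight_time_def)
  qed
  finally show ?thesis using k by (intro exI[of _ ?k]) auto
qed

lemma flight_time_ex1:
  assumes "0 < p" "0 < q" "0 < T"
  shows "\<exists>!k. k < (pi / 2)\<^sup>2 \<and> 0 < half_span_sq p q k \<and> flight_time p q k = T"
proof (rule ex_ex1I)
  obtain k0 where k0: "k0 < 0" "flight_time p q k0 < T" using flight_time_small[OF assms] by blast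
  obtain k1 where k1: "0 < k1" "k1 < (pi / 2)\<^sup>2" "T < flight_time p q k1"
    using flight_time_large[OF assms(1,2)] by blast
  have "continuous_on {k0..k1} (flight_time p q)" using k1 by (intro continuous_on_flight_time) auto
  then obtain k where k: "k0 \<le> k" "k \<le> k1" "flight_time p q k = T"
    using IVT'[of "flight_time p q" k0 T k1] k0 k1 by auto
  \<comment> \<open>\<open>sqrt\<close> has the sign of its argument, so a positive flight time
    rules out the parameters to which no orbit belongs.\<close>
  have "0 < sqrt (half_span_sq p q k) * mean_radius p q k"
    using k(3) assms by (simp add: flight_time_def)
  moreover have "0 < mean_radius p q k" using k k1 assms by (intro mean_radius_pos) auto
  ultimately have "0 < half_span_sq p q k" by (simp add: zero_less_mult_iff)
  then show "\<exists>k. k < (pi / 2)\<^sup>2 \<and> 0 < half_span_sq p q k \<and> flight_time p q k = T" using k k1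
    by (intro exI[of _ k]) auto
next
  fix k l assume "k < (pi / 2)\<^sup>2 \<and> 0 < half_span_sq p q k \<and> flight_time p q k = T"
    "l < (pi / 2)\<^sup>2 \<and> 0 < half_span_sq p q l \<and> flight_time p q l = T"
  then show "k = l" using flight_time_strict_mono[OF assms(1,2), of k l] flight_time_strict_mono[OF assms(1,2), of l k]
    by (cases k l rule: linorder_cases) auto
qed

section \<open>Lifted orbits\<close>

text \<open>\<open>lc_pos\<close> is the solution of \<open>z'' = - k z\<close> with initial data \<open>(a, b)\<close>, \<open>lc_vel\<close> its derivative, and
  \<open>lc_time\<close> the primitive of \<open>|z|\<^sup>2\<close>, i.e. physical time.\<close>

definition lc_pos :: "complex \<Rightarrow> complex \<Rightarrow> real \<Rightarrow> real \<Rightarrow> complex" where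
  "lc_pos a b k s = cosk k s *\<^sub>R a + sink k s *\<^sub>R b"

definition lc_vel :: "complex \<Rightarrow> complex \<Rightarrow> real \<Rightarrow> real \<Rightarrow> complex" where
  "lc_vel a b k s = cosk k s *\<^sub>R b - (k * sink k s) *\<^sub>R a"

definition lc_time :: "complex \<Rightarrow> complex \<Rightarrow> real \<Rightarrow> real \<Rightarrow> real" where
  "lc_time a b k s = (norm a)\<^sup>2 * cosk_sq_int k s + (norm b)\<^sup>2 * sink_sq_int k s + (a \<bullet> b) * (sink k s)\<^sup>2"

lemma lc_pos_zero [simp]: "lc_pos a b k 0 = a" and lc_vel_zero [simp]: "lc_vel a b k 0 = b"
  and lc_time_zero [simp]: "lc_time a b k 0 = 0"
  by (simp_all add: lc_pos_def lc_vel_def lc_time_def)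

lemma has_vector_derivative_lc_pos:
  "(lc_pos a b k has_vector_derivative lc_vel a b k s) (at s within X)"
proof -
  have "(lc_pos a b k has_vector_derivative
     ((cosk k s *\<^sub>R 0 + (- k * sink k s) *\<^sub>R a) + (sink k s *\<^sub>R 0 + cosk k s *\<^sub>R b))) (at s within X)"
    unfolding lc_pos_def[abs_def]
    by (intro has_vector_derivative_add has_vector_derivative_scaleR has_real_derivative_cosk
        has_real_derivative_sink has_vector_derivative_const)
  then show ?thesis by (simp add: lc_vel_def)
qed

lemma has_vector_derivative_lc_vel:
  "(lc_vel a b k has_vector_derivative - k *\<^sub>R lc_pos a b k s) (at s within X)"
proof -
  have "(lc_vel a b k has_vector_derivative
     ((cosk k s *\<^sub>R 0 + (- k * sink k s) *\<^sub>R b) - ((k * sink k s) *\<^sub>R 0 + (k * cosk k s) *\<^sub>R a))) (at s within X)"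
    unfolding lc_vel_def[abs_def]
    by (intro has_vector_derivative_diff has_vector_derivative_scaleR has_real_derivative_cosk
        has_real_derivative_sink has_vector_derivative_const DERIV_cmult)
  moreover have "(cosk k s *\<^sub>R 0 + (- k * sink k s) *\<^sub>R b) - ((k * sink k s) *\<^sub>R 0 + (k * cosk k s) *\<^sub>R a)
     = - k *\<^sub>R lc_pos a b k s" by (simp add: lc_pos_def algebra_simps)
  ultimately show ?thesis by metis
qed

lemma continuous_on_lc_pos: "continuous_on X (lc_pos a b k)"
  by (rule continuous_on_vector_derivative[OF has_vector_derivative_lc_pos])

lemma continuous_on_lc_vel: "continuous_on X (lc_vel a b k)"
  by (rule continuous_on_vector_derivative[OF has_vector_derivative_lc_vel])

lemma energy_lc_pos:
  "(norm (lc_vel a b k s))\<^sup>2 + k * (norm (lc_pos a b k s))\<^sup>2 = (norm b)\<^sup>2 + k * (norm a)\<^sup>2"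
proof -
  have "(norm (lc_vel a b k s))\<^sup>2 + k * (norm (lc_pos a b k s))\<^sup>2
     = ((cosk k s)\<^sup>2 + k * (sink k s)\<^sup>2) * ((norm b)\<^sup>2 + k * (norm a)\<^sup>2)"
    unfolding power2_norm_eq_inner lc_pos_def lc_vel_def
    by (simp add: inner_add inner_diff inner_commute power2_eq_square algebra_simps)
  then show ?thesis by (simp add: cosk_sink_squares)
qed

lemma lc_pos_shift: "lc_pos a b k (s + t) = lc_pos (lc_pos a b k s) (lc_vel a b k s) k t"
  by (simp add: lc_pos_def lc_vel_def cosk_add sink_add algebra_simps)

lemma lc_vel_shift: "lc_vel a b k (s + t) = lc_vel (lc_pos a b k s) (lc_vel a b k s) k t"
  by (simp add: lc_pos_def lc_vel_def cosk_add sink_add algebra_simps)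

lemma has_real_derivative_lc_time:
  "(lc_time a b k has_real_derivative (norm (lc_pos a b k s))\<^sup>2) (at s within X)"
proof -
  have "(lc_time a b k has_real_derivative
     (norm a)\<^sup>2 * (cosk k s)\<^sup>2 + (norm b)\<^sup>2 * (sink k s)\<^sup>2 + (a \<bullet> b) * (2 * sink k s * cosk k s)) (at s within X)"
    unfolding lc_time_def[abs_def]
    by (auto intro!: derivative_eq_intros simp: power2_eq_square)
  moreover have "(norm a)\<^sup>2 * (cosk k s)\<^sup>2 + (norm b)\<^sup>2 * (sink k s)\<^sup>2 + (a \<bullet> b) * (2 * sink k s * cosk k s)
     = (norm (lc_pos a b k s))\<^sup>2"
    unfolding power2_norm_eq_inner lc_pos_def
    by (simp add: inner_add inner_commute power2_eq_square algebra_simps)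
  ultimately show ?thesis by simp
qed

lemma isCont_lc_time: "isCont (lc_time a b k) s"
  by (rule DERIV_isCont[OF has_real_derivative_lc_time])

text \<open>Both sides have the same derivative in \<open>t\<close> and agree at 0, which replaces
  addition formulas for the integrated profiles.\<close>

lemma lc_time_shift: "lc_time a b k (s + t) = lc_time a b k s + lc_time (lc_pos a b k s) (lc_vel a b k s) k t"
proof -
  let ?D = "\<lambda>t. lc_time a b k (s + t) - lc_time (lc_pos a b k s) (lc_vel a b k s) k t"
  have "(?D has_real_derivative 0) (at t)" for t
  proof -
    have "((\<lambda>t. lc_time a b k (s + t)) has_real_derivative (norm (lc_pos a b k (s + t)))\<^sup>2) (at t)"
    proof -
      have "((\<lambda>t. s + t) has_real_derivative 1) (at t)" by (auto intro!: derivative_eq_intros)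
      from DERIV_chain2[OF has_real_derivative_lc_time this] show ?thesis by simp
    qed
    from DERIV_diff[OF this has_real_derivative_lc_time[of "lc_pos a b k s" "lc_vel a b k s" k]]
    show ?thesis by (simp add: lc_pos_shift)
  qed
  then have "?D t = ?D 0" using DERIV_isconst_all by blast
  then show ?thesis by simp
qed

text \<open>The derivative \<open>|z|^2\<close> vanishes at collisions, so only weak monotonicity is
  immediate. If time stood still on an interval, \<open>z\<close> and then also \<open>z'\<close>
  would vanish there, against the positive energy of the oscillator.\<close>

lemma lc_time_strict_mono:
  assumes "0 < (norm b)\<^sup>2 + k * (norm a)\<^sup>2" "s < t"
  shows "lc_time a b k s < lc_time a b k t"
proof -
  have mono: "lc_time a b k x \<le> lc_time a b k y" if "x \<le> y" for x y
    using that by (rule DERIV_nonneg_imp_nondecreasing) (meson has_real_derivative_lc_time zero_le_power2)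
  show ?thesis
  proof (rule ccontr)
    assume "\<not> ?thesis"
    then have const: "lc_time a b k x = lc_time a b k s" if "x \<in> {s<..<t}" for x
      using that mono[of s x] mono[of x t] by auto
    have z0: "lc_pos a b k x = 0" if x: "x \<in> {s<..<t}" for x
    proof -
      have "(lc_time a b k has_real_derivative 0) (at x)"
        by (rule has_field_derivative_transform_within_open[OF _ _ x])
           (use const in \<open>auto intro!: derivative_eq_intros\<close>)
      then have "(norm (lc_pos a b k x))\<^sup>2 = 0"
        using has_real_derivative_lc_time DERIV_unique by blast
      then show ?thesis by simp
    qed
    obtain x where x: "x \<in> {s<..<t}" using dense[OF assms(2)] by auto
    have "(lc_pos a b k has_vector_derivative 0) (at x)"
      by (rule has_vector_derivative_transform_within_open[OF _ _ x, where f = "\<lambda>_. 0"])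
        (use z0 in auto)
    then have "lc_vel a b k x = 0"
      using has_vector_derivative_lc_pos vector_derivative_unique_at by blast
    then show False using energy_lc_pos[of a b k x] z0[OF x] assms(1) by simp
  qed
qed

definition kepler_curve :: "complex \<Rightarrow> complex \<Rightarrow> real \<Rightarrow> real \<Rightarrow> complex" where
  "kepler_curve a b k t = (lc_pos a b k (inv (lc_time a b k) t))\<^sup>2"

text \<open>The chain rule value \<open>dq/dt = 2 z z' / |z|^2\<close>, indexed by the regularised
  time \<open>s\<close> and not by \<open>t\<close>.\<close>

definition kepler_velocity :: "complex \<Rightarrow> complex \<Rightarrow> real \<Rightarrow> real \<Rightarrow> complex" where
  "kepler_velocity a b k s = (2 / (norm (lc_pos a b k s))\<^sup>2) *\<^sub>R (lc_pos a b k s * lc_vel a b k s)"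

section \<open>Projected orbits satisfy the Kepler equation\<close>

context
  fixes a b :: complex and k :: real
  assumes energy: "2 * ((norm b)\<^sup>2 + k * (norm a)\<^sup>2) = 1"
begin

lemma inj_lc_time: "inj (lc_time a b k)"
proof (rule injI)
  fix x y assume "lc_time a b k x = lc_time a b k y"
  then show "x = y" using lc_time_strict_mono[of b k a x y] lc_time_strict_mono[of b k a y x] energy
    by (cases x y rule: linorder_cases) auto
qed

lemma inv_lc_time [simp]: "inv (lc_time a b k) (lc_time a b k s) = s"
  by (simp add: inj_lc_time)

lemma lc_time_less_iff: "lc_time a b k s < lc_time a b k t \<longleftrightarrow> s < t"
proof -
  have pos: "0 < (norm b)\<^sup>2 + k * (norm a)\<^sup>2" using zero_less_mult_pos[of 2 "(norm b)\<^sup>2 + k * (norm a)\<^sup>2"] energy by (metis zero_less_numeral zero_less_one)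
  show ?thesis
    using lc_time_strict_mono[OF pos, of s t] lc_time_strict_mono[OF pos, of t s]
    by (cases s t rule: linorder_cases) auto
qed

lemma lc_time_le_iff: "lc_time a b k s \<le> lc_time a b k t \<longleftrightarrow> s \<le> t"
  using lc_time_less_iff by (meson not_less)

lemma kepler_curve_lc_time [simp]: "kepler_curve a b k (lc_time a b k s) = (lc_pos a b k s)\<^sup>2"
  by (simp add: kepler_curve_def)

lemma lc_time_onto:
  assumes "0 \<le> H" "t \<in> {0..lc_time a b k H}"
  obtains s where "s \<in> {0..H}" "t = lc_time a b k s"
  using IVT[of "lc_time a b k" 0 t H] assms isCont_lc_time by auto

lemma isCont_inv_lc_time: "isCont (inv (lc_time a b k)) (lc_time a b k s)"
  by (rule isCont_inverse_function2[of "s - 1" s "s + 1"]) (auto simp: isCont_lc_time)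

lemma inv_lc_time_has_derivative:
  assumes "lc_pos a b k s \<noteq> 0"
  shows "(inv (lc_time a b k) has_real_derivative 1 / (norm (lc_pos a b k s))\<^sup>2) (at (lc_time a b k s))"
proof -
  have "(inv (lc_time a b k) has_real_derivative inverse ((norm (lc_pos a b k s))\<^sup>2)) (at (lc_time a b k s))"
  proof (rule DERIV_inverse_function[of "lc_time a b k" _ _ _ "lc_time a b k (s - 1)" "lc_time a b k (s + 1)"])
    show "(lc_time a b k has_real_derivative (norm (lc_pos a b k s))\<^sup>2)
       (at (inv (lc_time a b k) (lc_time a b k s)))"
      by (simp add: has_real_derivative_lc_time)
    fix y assume y: "lc_time a b k (s - 1) < y" "y < lc_time a b k (s + 1)"
    then obtain x where "lc_time a b k x = y"
      using IVT[of "lc_time a b k" "s - 1" y "s + 1"] isCont_lc_time by auto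
    then show "lc_time a b k (inv (lc_time a b k) y) = y" by auto
  qed (use assms isCont_inv_lc_time in \<open>auto simp: lc_time_less_iff\<close>)
  then show ?thesis by (simp add: inverse_eq_divide)
qed

lemma kepler_curve_has_derivative:
  assumes "lc_pos a b k s \<noteq> 0"
  shows "(kepler_curve a b k has_vector_derivative kepler_velocity a b k s) (at (lc_time a b k s))"
proof -
  have "((\<lambda>s. lc_pos a b k s * lc_pos a b k s) has_vector_derivative (lc_pos a b k s * lc_vel a b k s + lc_vel a b k s * lc_pos a b k s)) (at s)"
    by (intro has_vector_derivative_mult has_vector_derivative_lc_pos)
  then have "((\<lambda>s. lc_pos a b k s * lc_pos a b k s) has_vector_derivative (lc_pos a b k s * lc_vel a b k s + lc_vel a b k s * lc_pos a b k s))
     (at (inv (lc_time a b k) (lc_time a b k s)))" by simp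
  from vector_diff_chain_at[OF inv_lc_time_has_derivative[OF assms, unfolded has_real_derivative_iff_has_vector_derivative] this]
  show ?thesis
    by (simp add: kepler_curve_def[abs_def] kepler_velocity_def o_def power2_eq_square algebra_simps scaleR_conv_of_real)
qed

text \<open>The chain rule gives the second derivative as a polynomial in \<open>z\<close> and
  \<open>z'\<close> over powers of \<open>n = |z|^2\<close>. Multiplied by \<open>n^3\<close> it
  becomes \<open>- z^2\<close> times the left side of the energy relation, which is 1.\<close>

lemma kepler_velocity_has_derivative:
  assumes nz: "lc_pos a b k s \<noteq> 0"
  shows "((\<lambda>t. kepler_velocity a b k (inv (lc_time a b k) t)) has_vector_derivative
     - (1 / norm ((lc_pos a b k s)\<^sup>2) ^ 3) *\<^sub>R (lc_pos a b k s)\<^sup>2) (at (lc_time a b k s))"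
proof -
  let ?z = "lc_pos a b k" and ?y = "lc_vel a b k"
  define n where "n = (norm (?z s))\<^sup>2"
  have n: "n \<noteq> 0" using nz by (simp add: n_def)
  have dn: "((\<lambda>s. (norm (?z s))\<^sup>2) has_real_derivative 2 * (?z s \<bullet> ?y s)) (at s)"
  proof -
    have "((\<lambda>s. ?z s \<bullet> ?z s) has_vector_derivative ?z s \<bullet> ?y s + ?y s \<bullet> ?z s) (at s)"
      by (intro bounded_bilinear.has_vector_derivative[OF bounded_bilinear_inner] has_vector_derivative_lc_pos)
    then show ?thesis
      by (simp add: power2_norm_eq_inner inner_commute has_real_derivative_iff_has_vector_derivative)
  qed
  have "((\<lambda>s. 2 / f s) has_real_derivative - (2 * D) / (f s * f s)) (at s)"
    if "(f has_real_derivative D) (at s)" "f s \<noteq> 0" for f :: "real \<Rightarrow> real" and D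
    using that by (auto intro!: derivative_eq_intros)
  from this[OF dn] have "((\<lambda>s. 2 / (norm (?z s))\<^sup>2) has_real_derivative - 4 * (?z s \<bullet> ?y s) / (n * n)) (at s)"
    using nz by (simp add: n_def)
  then have "(kepler_velocity a b k has_vector_derivative
      ((2 / n) *\<^sub>R (?z s * (- k *\<^sub>R ?z s) + ?y s * ?y s) + (- 4 * (?z s \<bullet> ?y s) / (n * n)) *\<^sub>R (?z s * ?y s))) (at s)"
    unfolding kepler_velocity_def[abs_def] n_def
    by (intro has_vector_derivative_scaleR has_vector_derivative_mult has_vector_derivative_lc_pos has_vector_derivative_lc_vel) auto
  then have "(kepler_velocity a b k has_vector_derivative
      ((2 / n) *\<^sub>R (?z s * (- k *\<^sub>R ?z s) + ?y s * ?y s) + (- 4 * (?z s \<bullet> ?y s) / (n * n)) *\<^sub>R (?z s * ?y s)))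
      (at (inv (lc_time a b k) (lc_time a b k s)))" by simp
  from vector_diff_chain_at[OF inv_lc_time_has_derivative[OF assms, unfolded has_real_derivative_iff_has_vector_derivative] this]
  have *: "((\<lambda>t. kepler_velocity a b k (inv (lc_time a b k) t)) has_vector_derivative
     (1 / n) *\<^sub>R ((2 / n) *\<^sub>R (?z s * (- k *\<^sub>R ?z s) + ?y s * ?y s) + (- 4 * (?z s \<bullet> ?y s) / (n * n)) *\<^sub>R (?z s * ?y s)))
     (at (lc_time a b k s))"
    by (simp add: o_def n_def)
  let ?R = "(1 / n) *\<^sub>R ((2 / n) *\<^sub>R (?z s * (- k *\<^sub>R ?z s) + ?y s * ?y s) + (- 4 * (?z s \<bullet> ?y s) / (n * n)) *\<^sub>R (?z s * ?y s))"
  \<comment> \<open>With conjugates the norm, the inner product and the energy relation become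
    polynomial, and the remaining identity is ring algebra.\<close>
  have nn: "of_real n = ?z s * cnj (?z s)" unfolding n_def by (rule complex_norm_square)
  have ip: "of_real (2 * (?z s \<bullet> ?y s)) = ?z s * cnj (?y s) + cnj (?z s) * ?y s"
    by (simp add: complex_eq_iff inner_complex_def)
  have "2 * ((norm (?y s))\<^sup>2 + k * n) = 1" using energy_lc_pos[of a b k s] energy by (simp add: n_def)
  then have "complex_of_real (2 * ((norm (?y s))\<^sup>2 + k * n)) = 1" by simp
  then have en: "2 * (?y s * cnj (?y s) + of_real k * (?z s * cnj (?z s))) = 1"
    unfolding of_real_mult of_real_add nn complex_norm_square by simp
  have "n ^ 3 *\<^sub>R ?R
     = (2 * n) *\<^sub>R (?z s * (- k *\<^sub>R ?z s) + ?y s * ?y s) - (2 * (2 * (?z s \<bullet> ?y s))) *\<^sub>R (?z s * ?y s)"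
    using n by (simp add: scaleR_add_right scaleR_diff_right power3_eq_cube mult_ac)
  also have "\<dots> = - (?z s)\<^sup>2"
  proof -
    have "(2 * n) *\<^sub>R (?z s * (- k *\<^sub>R ?z s) + ?y s * ?y s) - (2 * (2 * (?z s \<bullet> ?y s))) *\<^sub>R (?z s * ?y s)
      = 2 * of_real n * (?z s * (- of_real k * ?z s) + ?y s * ?y s) - 2 * of_real (2 * (?z s \<bullet> ?y s)) * (?z s * ?y s)"
      by (simp add: scaleR_conv_of_real)
    also have "\<dots> = - (2 * (?y s * cnj (?y s) + of_real k * (?z s * cnj (?z s)))) * (?z s)\<^sup>2"
      unfolding nn ip by (simp add: algebra_simps power2_eq_square)
    finally show ?thesis unfolding en by simp
  qed
  finally have "n ^ 3 *\<^sub>R ?R = - (?z s)\<^sup>2" .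
  moreover have "?R = (1 / n ^ 3) *\<^sub>R (n ^ 3 *\<^sub>R ?R)" using n by simp
  ultimately have "?R = (1 / n ^ 3) *\<^sub>R (- (?z s)\<^sup>2)" by (simp only:)
  also have "\<dots> = - (1 / norm ((?z s)\<^sup>2) ^ 3) *\<^sub>R (?z s)\<^sup>2" by (simp add: n_def norm_power)
  finally show ?thesis using * by simp
qed

lemma norm_kepler_velocity:
  assumes nz: "lc_pos a b k s \<noteq> 0"
  shows "norm (kepler_velocity a b k s) ^ 2 / 2 - 1 / norm ((lc_pos a b k s)\<^sup>2) = - 2 * k"
proof -
  have "2 * ((norm (lc_vel a b k s))\<^sup>2 + k * (norm (lc_pos a b k s))\<^sup>2) = 1" using energy_lc_pos[of a b k s] energy by simp
  then have "2 * (norm (lc_vel a b k s))\<^sup>2 - 1 = - 2 * k * (norm (lc_pos a b k s))\<^sup>2" by simp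
  then show ?thesis using nz
    by (simp add: kepler_velocity_def norm_mult norm_power power_mult_distrib power_divide field_simps power2_eq_square)
qed

end

section \<open>Lifted orbits project to simple arcs\<close>

definition ckepler_arc :: "(real \<Rightarrow> complex) \<Rightarrow> real \<Rightarrow> bool" where
  "ckepler_arc q T \<longleftrightarrow>
     0 < T \<and> continuous_on {0..T} q \<and> finite {t \<in> {0..T}. q t = 0} \<and>
     (\<exists>v E. \<forall>t \<in> {0..T}. q t \<noteq> 0 \<longrightarrow>
        (q has_vector_derivative v t) (at t within {0..T}) \<and>
        (v has_vector_derivative (- (1 / norm (q t) ^ 3) *\<^sub>R q t)) (at t within {0..T}) \<and>
        norm (v t) ^ 2 / 2 - 1 / norm (q t) = E) \<and>
     ((\<exists>t \<in> {0..T}. q t = 0) \<longrightarrow> (\<exists>u. \<forall>t \<in> {0..T}. \<exists>s\<ge>0. q t = s *\<^sub>R u))"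

definition cmulti_revolution :: "(real \<Rightarrow> complex) \<Rightarrow> real \<Rightarrow> bool" where
  "cmulti_revolution q T \<longleftrightarrow> 0 \<in> convex hull (q ` {0..T}) \<and>
     (\<exists>P>0. P < T \<and> (\<forall>t. t \<in> {0..T} \<and> t + P \<in> {0..T} \<longrightarrow> q (t + P) = q t))"

context
  fixes a b :: complex and k H :: real
  assumes energy: "2 * ((norm b)\<^sup>2 + k * (norm a)\<^sup>2) = 1"
    and H: "0 < H" "k * H\<^sup>2 < pi\<^sup>2"
begin

lemma sink_pos_span: "0 < d \<Longrightarrow> d \<le> H \<Longrightarrow> 0 < sink k d"
  using H(2) by (intro sink_positive mult_square_less_mono[OF H(2)]) auto

lemma lc_vel_nonzero: "lc_pos a b k s = 0 \<Longrightarrow> lc_vel a b k s \<noteq> 0"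
  using energy_lc_pos[of a b k s] energy by auto

text \<open>After a zero at \<open>x\<close> the lift is \<open>sink k (y - x)\<close> times the
  nonzero velocity at \<open>x\<close>, and \<open>sink\<close> stays positive on this span. Hence
  there is at most one collision.\<close>

lemma lc_pos_zero_unique:
  assumes "s \<in> {0..H}" "t \<in> {0..H}" "lc_pos a b k s = 0" "lc_pos a b k t = 0"
  shows "s = t"
proof -
  have False if "x < y" "x \<in> {0..H}" "y \<in> {0..H}" "lc_pos a b k x = 0" "lc_pos a b k y = 0" for x y
  proof -
    have "lc_pos a b k y = sink k (y - x) *\<^sub>R lc_vel a b k x"
      using lc_pos_shift[of a b k x "y - x"] that by (simp add: lc_pos_def[of 0])
    moreover have "sink k (y - x) > 0" using that by (intro sink_pos_span) auto
    ultimately show False using that lc_vel_nonzero[of x] by simp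
  qed
  then show ?thesis using assms by (cases s t rule: linorder_cases) auto
qed

lemma kepler_curve_arc: "ckepler_arc (kepler_curve a b k) (lc_time a b k H)"
  unfolding ckepler_arc_def
proof (intro conjI)
  let ?T = "lc_time a b k H" and ?q = "kepler_curve a b k"
  show "0 < ?T" using lc_time_less_iff[OF energy, of 0 H] H by simp
  show "continuous_on {0..?T} ?q"
  proof (intro continuous_at_imp_continuous_on ballI)
    fix t assume "t \<in> {0..?T}"
    then obtain s where s: "t = lc_time a b k s" using lc_time_onto[OF energy, of H t] H by auto
    have "isCont (\<lambda>t. lc_pos a b k (inv (lc_time a b k) t)) t"
      by (rule isCont_o2[where g = "lc_pos a b k" and f = "inv (lc_time a b k)"])
        (use isCont_inv_lc_time[OF energy, of s] continuous_on_lc_pos[of UNIV a b k] in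
          \<open>auto simp: s continuous_on_eq_continuous_at\<close>)
    then show "isCont ?q t" unfolding kepler_curve_def[abs_def] by (intro continuous_intros)
  qed
  have "t = t'" if tt: "t \<in> {0..?T}" "?q t = 0" "t' \<in> {0..?T}" "?q t' = 0" for t t'
  proof -
    obtain s where s: "t = lc_time a b k s" "s \<in> {0..H}" using lc_time_onto[OF energy, of H t] H tt by auto
    obtain s' where s': "t' = lc_time a b k s'" "s' \<in> {0..H}" using lc_time_onto[OF energy, of H t'] H tt by auto
    show ?thesis using lc_pos_zero_unique[of s s'] s s' tt by (simp add: kepler_curve_lc_time[OF energy])
  qed
  then have "{t \<in> {0..?T}. ?q t = 0} \<subseteq> {THE t. t \<in> {0..?T} \<and> ?q t = 0}"
    by (auto intro!: the_equality[symmetric])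
  then show "finite {t \<in> {0..?T}. ?q t = 0}" by (rule finite_subset) simp
  show "\<exists>v E. \<forall>t \<in> {0..?T}. ?q t \<noteq> 0 \<longrightarrow>
        (?q has_vector_derivative v t) (at t within {0..?T}) \<and>
        (v has_vector_derivative (- (1 / norm (?q t) ^ 3) *\<^sub>R ?q t)) (at t within {0..?T}) \<and>
        norm (v t) ^ 2 / 2 - 1 / norm (?q t) = E"
  proof (rule exI[of _ "\<lambda>t. kepler_velocity a b k (inv (lc_time a b k) t)"], rule exI[of _ "- 2 * k"], intro ballI impI)
    fix t assume "t \<in> {0..?T}" and nz: "?q t \<noteq> 0"
    then obtain s where s: "t = lc_time a b k s" using lc_time_onto[OF energy, of H t] H by auto
    let ?v = "\<lambda>t. kepler_velocity a b k (inv (lc_time a b k) t)"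
    have nz': "lc_pos a b k s \<noteq> 0" using nz by (simp add: s kepler_curve_lc_time[OF energy])
    show "(?q has_vector_derivative ?v t) (at t within {0..?T}) \<and>
        (?v has_vector_derivative (- (1 / norm (?q t) ^ 3) *\<^sub>R ?q t)) (at t within {0..?T}) \<and>
        norm (?v t) ^ 2 / 2 - 1 / norm (?q t) = - 2 * k"
      using kepler_curve_has_derivative[OF energy nz'] kepler_velocity_has_derivative[OF energy nz']
        norm_kepler_velocity[OF energy nz']
      by (auto simp: s kepler_curve_lc_time[OF energy] inv_lc_time[OF energy] intro: has_vector_derivative_at_within)
  qed
  show "(\<exists>t \<in> {0..?T}. ?q t = 0) \<longrightarrow> (\<exists>u. \<forall>t \<in> {0..?T}. \<exists>s\<ge>0. ?q t = s *\<^sub>R u)"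
  proof
    assume "\<exists>t \<in> {0..?T}. ?q t = 0"
    then obtain s where s: "lc_pos a b k s = 0" "s \<in> {0..H}"
      using lc_time_onto[OF energy, of H] H by (auto simp: kepler_curve_lc_time[OF energy]) (metis atLeastAtMost_iff kepler_curve_lc_time[OF energy] zero_eq_power2)
    show "\<exists>u. \<forall>t \<in> {0..?T}. \<exists>s\<ge>0. ?q t = s *\<^sub>R u"
    \<comment> \<open>Seen from the collision, the lift runs along a line through 0 with a factor
      \<open>sink k (x - s)\<close> that changes sign there. Squaring removes the sign: this is the
      bounce along one ray.\<close>
    proof (rule exI[of _ "(lc_vel a b k s)\<^sup>2"], rule ballI)
      fix t assume "t \<in> {0..?T}"
      then obtain x where x: "t = lc_time a b k x" using lc_time_onto[OF energy, of H t] H by auto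
      have "lc_pos a b k x = sink k (x - s) *\<^sub>R lc_vel a b k s"
        using lc_pos_shift[of a b k s "x - s"] s by (simp add: lc_pos_def[of 0])
      then have "?q t = (sink k (x - s))\<^sup>2 *\<^sub>R (lc_vel a b k s)\<^sup>2"
        by (simp add: x kepler_curve_lc_time[OF energy] scaleR_power)
      then show "\<exists>r\<ge>0. ?q t = r *\<^sub>R (lc_vel a b k s)\<^sup>2" by (intro exI[of _ "(sink k (x - s))\<^sup>2"]) auto
    qed
  qed
qed

text \<open>A period \<open>P\<close> gives equal positions and, by differentiation, equal
  velocities at the times 0 and \<open>P\<close>. The lift then carries \<open>(a, b)\<close> to
  itself or to its negative, and positivity of \<open>sink k d\<close> together with the energy
  relation excludes such an eigenvector.\<close>

lemma kepler_curve_not_multi_revolution: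
  assumes a: "a \<noteq> 0" shows "\<not> cmulti_revolution (kepler_curve a b k) (lc_time a b k H)"
proof
  let ?T = "lc_time a b k H" and ?q = "kepler_curve a b k"
  assume "cmulti_revolution ?q ?T"
  then obtain P where P: "0 < P" "P < ?T" and per: "\<And>t. t \<in> {0..?T} \<Longrightarrow> t + P \<in> {0..?T} \<Longrightarrow> ?q (t + P) = ?q t"
    by (auto simp: cmulti_revolution_def)
  obtain d where d: "d \<in> {0..H}" "P = lc_time a b k d" using lc_time_onto[OF energy, of H P] H P by auto
  have d0: "0 < d" using P d by (cases "d = 0") auto
  have q0: "?q P = ?q 0" using per[of 0] P by simp
  have "?q 0 = a\<^sup>2" using kepler_curve_lc_time[OF energy, of 0] by simp
  moreover have "?q P = (lc_pos a b k d)\<^sup>2" using kepler_curve_lc_time[OF energy, of d] d by simp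
  ultimately have "(lc_pos a b k d)\<^sup>2 = a\<^sup>2" using q0 by simp
  then obtain e :: real where e: "e = 1 \<or> e = -1" "lc_pos a b k d = e *\<^sub>R a"
    by (metis power2_eq_iff scaleR_one scaleR_minus1_left)
  have nz: "lc_pos a b k d \<noteq> 0" using e a by auto
  \<comment> \<open>Periodicity holds only while \<open>t + P\<close> stays in the time interval, so
    the velocities are compared through one-sided derivatives on \<open>{0..T - P}\<close>.\<close>
  have "kepler_velocity a b k 0 = kepler_velocity a b k d"
  proof (rule vector_derivative_unique_within)
    show "at 0 within {0..?T - P} \<noteq> bot" using P by (simp add: trivial_limit_within islimpt_Icc)
    show "(?q has_vector_derivative kepler_velocity a b k 0) (at 0 within {0..?T - P})"
      using kepler_curve_has_derivative[OF energy, of 0] a by (auto intro: has_vector_derivative_at_within)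
    have "(?q has_vector_derivative kepler_velocity a b k d) (at (0 + P))"
      using kepler_curve_has_derivative[OF energy nz] d by simp
    moreover have "((\<lambda>t. t + P) has_vector_derivative 1) (at 0)"
      unfolding has_real_derivative_iff_has_vector_derivative[symmetric] by (auto intro!: derivative_eq_intros)
    ultimately have "((\<lambda>t. ?q (t + P)) has_vector_derivative kepler_velocity a b k d) (at 0)"
      using vector_diff_chain_at[of "\<lambda>t. t + P" 1 0 ?q] by (simp add: o_def)
    then have "((\<lambda>t. ?q (t + P)) has_vector_derivative kepler_velocity a b k d) (at 0 within {0..?T - P})"
      by (rule has_vector_derivative_at_within)
    then show "(?q has_vector_derivative kepler_velocity a b k d) (at 0 within {0..?T - P})"
      by (rule has_vector_derivative_transform[rotated 2]) (use P per in auto)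
  qed
  then have "(2 / (norm a)\<^sup>2) *\<^sub>R (a * b) = (2 / (norm a)\<^sup>2) *\<^sub>R (a * (e *\<^sub>R lc_vel a b k d))"
    using e by (auto simp: kepler_velocity_def)
  moreover have "2 / (norm a)\<^sup>2 \<noteq> 0" using a by simp
  ultimately have "a * b = a * (e *\<^sub>R lc_vel a b k d)" using scaleR_left_imp_eq by blast
  then have "b = e *\<^sub>R lc_vel a b k d" using a by (metis mult_cancel_left)
  then have "e *\<^sub>R b = (e * e) *\<^sub>R lc_vel a b k d" by (metis scaleR_scaleR)
  moreover have "e * e = 1" using e(1) by auto
  ultimately have "lc_vel a b k d = e *\<^sub>R b" by simp
  \<comment> \<open>The eigenvector equations. Eliminating \<open>b\<close> gives
    \<open>(C - e)^2 + k S^2 = 0\<close>; with \<open>C^2 + k S^2 = 1\<close> and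
    \<open>e^2 = 1\<close> this forces \<open>C = e\<close>, and then \<open>b = 0\<close> and
    \<open>k = 0\<close>.\<close>
  then have 1: "(cosk k d - e) *\<^sub>R a = - (sink k d *\<^sub>R b)" and 2: "(cosk k d - e) *\<^sub>R b = (k * sink k d) *\<^sub>R a"
    using e(2) by (simp_all add: lc_pos_def lc_vel_def algebra_simps)
  have sd: "0 < sink k d" using d d0 by (intro sink_pos_span) auto
  have "((cosk k d - e)\<^sup>2 + k * (sink k d)\<^sup>2) *\<^sub>R a = (cosk k d - e) *\<^sub>R ((cosk k d - e) *\<^sub>R a) + (k * sink k d * sink k d) *\<^sub>R a"
    by (simp add: scaleR_left_distrib power2_eq_square mult.assoc)
  also have "\<dots> = - (sink k d *\<^sub>R ((cosk k d - e) *\<^sub>R b)) + (k * sink k d * sink k d) *\<^sub>R a"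
    unfolding 1 by simp
  also have "\<dots> = 0" unfolding 2 by simp
  finally have "(cosk k d - e)\<^sup>2 + k * (sink k d)\<^sup>2 = 0" using a by simp
  then have "cosk k d = e" using cosk_sink_squares[of k d] e(1)
    by (auto simp: power2_eq_square algebra_simps)
  then have "b = 0" "k = 0" using 1 2 sd a by auto
  then show False using energy by simp
qed

end

section \<open>Every arc lifts\<close>

text \<open>The complex counterpart of \<open>energy_lc_pos\<close>. Up to the factor -2 this
  invariant is the eccentricity vector of the projected orbit.\<close>

lemma lc_pos_complex_energy:
  "(lc_vel a b k s)\<^sup>2 + k *\<^sub>R (lc_pos a b k s)\<^sup>2 = b\<^sup>2 + k *\<^sub>R a\<^sup>2"
proof -
  have "(lc_vel a b k s)\<^sup>2 + k *\<^sub>R (lc_pos a b k s)\<^sup>2 = ((cosk k s)\<^sup>2 + k * (sink k s)\<^sup>2) *\<^sub>R (b\<^sup>2 + k *\<^sub>R a\<^sup>2)"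
    unfolding lc_pos_def lc_vel_def
    by (simp add: power2_eq_square algebra_simps)
  then show ?thesis by (simp add: cosk_sink_squares)
qed

text \<open>The inverse flow of the oscillator applied to a solution \<open>(Y, Y1)\<close> returns
  its initial data. The statement is pointwise, with a clock \<open>s\<close> running at rate
  \<open>d\<close>, so that it can be used at the collision-free times only.\<close>

lemma oscillator_invariants:
  fixes Y Y1 :: "real \<Rightarrow> complex"
  assumes s: "(s has_real_derivative d) (at t within X)"
    and Y: "(Y has_vector_derivative d *\<^sub>R Y1 t) (at t within X)"
    and Y1: "(Y1 has_vector_derivative - (l * d) *\<^sub>R Y t) (at t within X)"
  shows "((\<lambda>t. cosk l (s t) *\<^sub>R Y t - sink l (s t) *\<^sub>R Y1 t) has_vector_derivative 0) (at t within X)"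
    and "((\<lambda>t. (l * sink l (s t)) *\<^sub>R Y t + cosk l (s t) *\<^sub>R Y1 t) has_vector_derivative 0) (at t within X)"
proof -
  have c: "((\<lambda>t. cosk l (s t)) has_real_derivative (- l * sink l (s t)) * d) (at t within X)"
    by (rule DERIV_chain2[OF has_real_derivative_cosk s])
  have d: "((\<lambda>t. sink l (s t)) has_real_derivative cosk l (s t) * d) (at t within X)"
    by (rule DERIV_chain2[OF has_real_derivative_sink s])
  have "((\<lambda>t. cosk l (s t) *\<^sub>R Y t - sink l (s t) *\<^sub>R Y1 t) has_vector_derivative
     (cosk l (s t) *\<^sub>R (d *\<^sub>R Y1 t) + ((- l * sink l (s t)) * d) *\<^sub>R Y t) -
     (sink l (s t) *\<^sub>R (- (l * d) *\<^sub>R Y t) + (cosk l (s t) * d) *\<^sub>R Y1 t)) (at t within X)"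
    by (intro has_vector_derivative_diff has_vector_derivative_scaleR c d Y Y1)
  moreover have "(cosk l (s t) *\<^sub>R (d *\<^sub>R Y1 t) + ((- l * sink l (s t)) * d) *\<^sub>R Y t) -
     (sink l (s t) *\<^sub>R (- (l * d) *\<^sub>R Y t) + (cosk l (s t) * d) *\<^sub>R Y1 t) = 0"
    by (simp add: algebra_simps)
  ultimately show "((\<lambda>t. cosk l (s t) *\<^sub>R Y t - sink l (s t) *\<^sub>R Y1 t) has_vector_derivative 0) (at t within X)"
    by metis
  have "((\<lambda>t. (l * sink l (s t)) *\<^sub>R Y t + cosk l (s t) *\<^sub>R Y1 t) has_vector_derivative
     ((l * sink l (s t)) *\<^sub>R (d *\<^sub>R Y1 t) + (l * (cosk l (s t) * d)) *\<^sub>R Y t) +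
     (cosk l (s t) *\<^sub>R (- (l * d) *\<^sub>R Y t) + ((- l * sink l (s t)) * d) *\<^sub>R Y1 t)) (at t within X)"
    by (intro has_vector_derivative_add has_vector_derivative_scaleR DERIV_cmult c d Y Y1)
  moreover have "((l * sink l (s t)) *\<^sub>R (d *\<^sub>R Y1 t) + (l * (cosk l (s t) * d)) *\<^sub>R Y t) +
     (cosk l (s t) *\<^sub>R (- (l * d) *\<^sub>R Y t) + ((- l * sink l (s t)) * d) *\<^sub>R Y1 t) = 0"
    by (simp add: algebra_simps)
  ultimately show "((\<lambda>t. (l * sink l (s t)) *\<^sub>R Y t + cosk l (s t) *\<^sub>R Y1 t) has_vector_derivative 0) (at t within X)"
    by metis
qed

text \<open>The two combinations have determinant \<open>C^2 + l S^2 = 1\<close>.\<close>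

lemma oscillator_zero:
  assumes "cosk l s *\<^sub>R Y - sink l s *\<^sub>R Y1 = (0::complex)" "(l * sink l s) *\<^sub>R Y + cosk l s *\<^sub>R Y1 = 0"
  shows "Y = 0"
proof -
  have "cosk l s *\<^sub>R (cosk l s *\<^sub>R Y - sink l s *\<^sub>R Y1) + sink l s *\<^sub>R ((l * sink l s) *\<^sub>R Y + cosk l s *\<^sub>R Y1)
     = ((cosk l s)\<^sup>2 + l * (sink l s)\<^sup>2) *\<^sub>R Y"
    by (simp add: algebra_simps power2_eq_square)
  then show ?thesis using assms by (simp add: cosk_sink_squares)
qed

text \<open>The means of passing through collisions: continuity bridges the finitely many times at
  which no derivative is known.\<close>

lemma constant_off_finite:
  fixes f :: "real \<Rightarrow> 'a::banach"
  assumes "finite Z" "continuous_on {0..T} f" "t \<in> {0..T}"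
    and "\<And>x. x \<in> {0..T} - Z \<Longrightarrow> (f has_vector_derivative 0) (at x within {0..T})"
  shows "f t = f 0"
  by (rule has_derivative_zero_unique_strong_interval[OF assms(1,2) refl _ assms(3)])
    (use assms(4) in \<open>auto simp: has_vector_derivative_def\<close>)

section \<open>Regularised variables along an arbitrary arc\<close>

locale ckepler =
  fixes q v :: "real \<Rightarrow> complex" and T E :: real
  assumes T: "0 < T" and cont: "continuous_on {0..T} q" and fin: "finite {t \<in> {0..T}. q t = 0}"
    and dq: "\<And>t. t \<in> {0..T} \<Longrightarrow> q t \<noteq> 0 \<Longrightarrow> (q has_vector_derivative v t) (at t within {0..T})"
    and dv: "\<And>t. t \<in> {0..T} \<Longrightarrow> q t \<noteq> 0 \<Longrightarrow>
       (v has_vector_derivative (- (1 / norm (q t) ^ 3) *\<^sub>R q t)) (at t within {0..T})"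
    and en: "\<And>t. t \<in> {0..T} \<Longrightarrow> q t \<noteq> 0 \<Longrightarrow> norm (v t) ^ 2 / 2 - 1 / norm (q t) = E"
    and ray: "\<exists>t \<in> {0..T}. q t = 0 \<Longrightarrow> \<exists>u. \<forall>t \<in> {0..T}. \<exists>s\<ge>0. q t = s *\<^sub>R u"
    and q0: "q 0 \<noteq> 0"
begin

text \<open>\<open>ftime\<close> is the regularised time \<open>\<integral> dt / |q|\<close>: by the virial identity its integrand is the derivative of
  \<open>q \<bullet> v - 2 E t\<close>, which stays continuous at collisions. With respect to it \<open>q' = w\<close> and
  \<open>w' = 2 E q - ecc\<close>, a linear system that is not singular at collisions.\<close>

definition w where "w t = norm (q t) *\<^sub>R v t"
definition virial where "virial t = q t \<bullet> v t"
definition ecc where "ecc t = ((norm (v t))\<^sup>2 - 1 / norm (q t)) *\<^sub>R q t - virial t *\<^sub>R v t"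
definition ftime where "ftime t = virial t - virial 0 - 2 * E * t"

text \<open>Energy conservation expresses the length of \<open>w\<close> through that of
  \<open>q\<close> alone, and at collisions both sides vanish. This makes \<open>w\<close>, and with
  it \<open>virial\<close>, continuous there, although \<open>v\<close> is unconstrained at
  collisions.\<close>

lemma norm_w: "t \<in> {0..T} \<Longrightarrow> norm (w t) = sqrt (2 * E * (norm (q t))\<^sup>2 + 2 * norm (q t))"
proof (cases "q t = 0")
  case False
  assume t: "t \<in> {0..T}"
  have "(norm (w t))\<^sup>2 = (norm (q t))\<^sup>2 * (norm (v t))\<^sup>2" by (simp add: w_def power_mult_distrib)
  also have "(norm (v t))\<^sup>2 = 2 * E + 2 / norm (q t)" using en[OF t False] by simp
  also have "(norm (q t))\<^sup>2 * (2 * E + 2 / norm (q t)) = 2 * E * (norm (q t))\<^sup>2 + 2 * norm (q t)"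
    using False by (simp add: field_simps power2_eq_square)
  finally show ?thesis by (metis norm_ge_zero real_sqrt_abs abs_of_nonneg)
qed (simp add: w_def)

lemma virial_le: "\<bar>virial t\<bar> \<le> norm (w t)"
  using Cauchy_Schwarz_ineq2[of "q t" "v t"] by (simp add: virial_def w_def)

lemma tendsto_w_collision:
  assumes "t \<in> {0..T}" "q t = 0"
  shows "((\<lambda>x. norm (w x)) \<longlongrightarrow> 0) (at t within {0..T})"
proof -
  have "(q \<longlongrightarrow> 0) (at t within {0..T})" using cont assms by (metis continuous_on_def)
  then have "((\<lambda>x. sqrt (2 * E * (norm (q x))\<^sup>2 + 2 * norm (q x))) \<longlongrightarrow> 0) (at t within {0..T})"
    using assms by (auto intro!: tendsto_eq_intros)
  then show ?thesis
    by (rule Lim_transform_eventually) (auto simp: eventually_at_filter norm_w)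
qed

lemma continuous_on_w: "continuous_on {0..T} w"
  unfolding continuous_on_def
proof
  fix t assume t: "t \<in> {0..T}"
  show "(w \<longlongrightarrow> w t) (at t within {0..T})"
  proof (cases "q t = 0")
    case True
    then show ?thesis using tendsto_norm_zero_cancel[OF tendsto_w_collision[OF t True]] by (simp add: w_def[of t])
  next
    case False
    then have "(v \<longlongrightarrow> v t) (at t within {0..T})" "(q \<longlongrightarrow> q t) (at t within {0..T})"
      using dv dq t has_vector_derivative_continuous continuous_within by blast+
    then show ?thesis unfolding w_def[abs_def] by (intro tendsto_intros)
  qed
qed

lemma continuous_on_virial: "continuous_on {0..T} virial"
  unfolding continuous_on_def
proof
  fix t assume t: "t \<in> {0..T}"
  show "(virial \<longlongrightarrow> virial t) (at t within {0..T})"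
  proof (cases "q t = 0")
    case True
    have "(virial \<longlongrightarrow> 0) (at t within {0..T})"
      by (rule Lim_null_comparison[OF _ tendsto_w_collision[OF t True]]) (simp add: virial_le)
    then show ?thesis using True by (simp add: virial_def)
  next
    case False
    then have "(v \<longlongrightarrow> v t) (at t within {0..T})" "(q \<longlongrightarrow> q t) (at t within {0..T})"
      using dv dq t has_vector_derivative_continuous continuous_within by blast+
    then show ?thesis unfolding virial_def[abs_def] by (intro tendsto_intros)
  qed
qed

context
  fixes t assumes t: "t \<in> {0..T}" and nz: "q t \<noteq> 0"
begin

lemma d_virial: "(virial has_real_derivative (norm (v t))\<^sup>2 - 1 / norm (q t)) (at t within {0..T})"
proof -
  have "(virial has_vector_derivative q t \<bullet> (- (1 / norm (q t) ^ 3) *\<^sub>R q t) + v t \<bullet> v t) (at t within {0..T})"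
    unfolding virial_def[abs_def]
    by (intro bounded_bilinear.has_vector_derivative[OF bounded_bilinear_inner] dq dv t nz)
  moreover have "q t \<bullet> (- (1 / norm (q t) ^ 3) *\<^sub>R q t) + v t \<bullet> v t = (norm (v t))\<^sup>2 - 1 / norm (q t)"
    using nz by (simp add: power2_norm_eq_inner[symmetric] power2_eq_square power3_eq_cube)
  ultimately show ?thesis by (metis has_real_derivative_iff_has_vector_derivative)
qed

lemma d_norm: "((\<lambda>t. norm (q t)) has_real_derivative virial t / norm (q t)) (at t within {0..T})"
proof -
  have "((\<lambda>t. q t \<bullet> q t) has_vector_derivative q t \<bullet> v t + v t \<bullet> q t) (at t within {0..T})"
    by (intro bounded_bilinear.has_vector_derivative[OF bounded_bilinear_inner] dq t nz)
  then have "((\<lambda>t. q t \<bullet> q t) has_real_derivative 2 * virial t) (at t within {0..T})"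
    by (simp add: virial_def inner_commute has_real_derivative_iff_has_vector_derivative)
  note A = this
  have "(sqrt has_real_derivative inverse (sqrt (q t \<bullet> q t)) / 2) (at (q t \<bullet> q t))"
    using nz by (intro DERIV_real_sqrt) simp
  from DERIV_chain2[OF this A] show ?thesis by (simp add: norm_eq_sqrt_inner[symmetric] inverse_eq_divide)
qed

lemma d_ftime: "(ftime has_real_derivative 1 / norm (q t)) (at t within {0..T})"
proof -
  have "(ftime has_real_derivative (norm (v t))\<^sup>2 - 1 / norm (q t) - 0 - 2 * E * 1) (at t within {0..T})"
    unfolding ftime_def[abs_def]
    by (intro DERIV_diff DERIV_const DERIV_cmult d_virial DERIV_ident)
  moreover have "(norm (v t))\<^sup>2 - 1 / norm (q t) - 0 - 2 * E * 1 = 1 / norm (q t)"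
    using en[OF t nz] by (simp add: field_simps)
  ultimately show ?thesis by metis
qed

lemma d_w: "(w has_vector_derivative (1 / norm (q t)) *\<^sub>R ((2 * E) *\<^sub>R q t - ecc t)) (at t within {0..T})"
proof -
  have "(w has_vector_derivative
     norm (q t) *\<^sub>R (- (1 / norm (q t) ^ 3) *\<^sub>R q t) + (virial t / norm (q t)) *\<^sub>R v t) (at t within {0..T})"
    unfolding w_def[abs_def] by (intro has_vector_derivative_scaleR d_norm dv t nz)
  moreover have "norm (q t) *\<^sub>R (- (1 / norm (q t) ^ 3) *\<^sub>R q t) + (virial t / norm (q t)) *\<^sub>R v t
      = (1 / norm (q t)) *\<^sub>R ((2 * E) *\<^sub>R q t - ecc t)"
  proof -
    have "(2 * E) *\<^sub>R q t - ecc t = (2 * E - (norm (v t))\<^sup>2 + 1 / norm (q t)) *\<^sub>R q t + virial t *\<^sub>R v t"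
      by (simp add: ecc_def algebra_simps)
    also have "2 * E - (norm (v t))\<^sup>2 + 1 / norm (q t) = - (1 / norm (q t))"
      using en[OF t nz] by (simp add: field_simps)
    finally show ?thesis using nz by (simp add: scaleR_diff_right power3_eq_cube)
  qed
  ultimately show ?thesis by metis
qed

lemma d_ecc: "(ecc has_vector_derivative 0) (at t within {0..T})"
proof -
  let ?A = "- (1 / norm (q t) ^ 3) *\<^sub>R q t"
  have "((\<lambda>t. v t \<bullet> v t) has_vector_derivative v t \<bullet> ?A + ?A \<bullet> v t) (at t within {0..T})"
    by (intro bounded_bilinear.has_vector_derivative[OF bounded_bilinear_inner] dv t nz)
  then have v2: "((\<lambda>t. (norm (v t))\<^sup>2) has_real_derivative - 2 * virial t / norm (q t) ^ 3) (at t within {0..T})"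
    by (simp add: power2_norm_eq_inner virial_def inner_commute has_real_derivative_iff_has_vector_derivative)
  have r: "((\<lambda>t. 1 / norm (q t)) has_real_derivative - (virial t / norm (q t) ^ 3)) (at t within {0..T})"
  proof -
    have "((\<lambda>s. 1 / f s) has_real_derivative - D / (f t * f t)) (at t within {0..T})"
      if "(f has_real_derivative D) (at t within {0..T})" "f t \<noteq> 0" for f :: "real \<Rightarrow> real" and D
      using that by (auto intro!: derivative_eq_intros)
    from this[OF d_norm] show ?thesis using nz by (simp add: power3_eq_cube mult.assoc)
  qed
  have "(ecc has_vector_derivative
     (((norm (v t))\<^sup>2 - 1 / norm (q t)) *\<^sub>R v t + (- 2 * virial t / norm (q t) ^ 3 - - (virial t / norm (q t) ^ 3)) *\<^sub>R q t)
     - (virial t *\<^sub>R ?A + ((norm (v t))\<^sup>2 - 1 / norm (q t)) *\<^sub>R v t)) (at t within {0..T})"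
    unfolding ecc_def[abs_def]
    by (intro has_vector_derivative_diff has_vector_derivative_scaleR DERIV_diff v2 r d_virial dq dv t nz)
  moreover have "(((norm (v t))\<^sup>2 - 1 / norm (q t)) *\<^sub>R v t + (- 2 * virial t / norm (q t) ^ 3 - - (virial t / norm (q t) ^ 3)) *\<^sub>R q t)
     - (virial t *\<^sub>R ?A + ((norm (v t))\<^sup>2 - 1 / norm (q t)) *\<^sub>R v t) = 0"
    by (simp add: algebra_simps flip: scaleR_add_left)
  ultimately show ?thesis by metis
qed

end

text \<open>Since \<open>Im (q * cnj u)\<close> vanishes identically, the velocity is a real
  multiple of \<open>u\<close>. The terms quadratic in the velocity then cancel, and only
  \<open>- q / |q|\<close> is left.\<close>

lemma ecc_rectilinear:
  assumes t: "t \<in> {0..T}" and nz: "q t \<noteq> 0"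
    and u: "\<And>t. t \<in> {0..T} \<Longrightarrow> \<exists>s\<ge>0. q t = s *\<^sub>R u"
  shows "ecc t = - sgn u"
proof -
  obtain r where r: "r \<ge> 0" "q t = r *\<^sub>R u" using u[OF t] by auto
  have u0: "u \<noteq> 0" and r0: "r > 0" using r nz by (cases "r = 0"; auto)+
  have A: "((\<lambda>t. Im (q t * cnj u)) has_vector_derivative Im (v t * cnj u)) (at t within {0..T})"
    by (intro bounded_linear.has_vector_derivative[OF bounded_linear_Im]
        has_vector_derivative_mult_left dq t nz)
  have B: "((\<lambda>t. Im (q t * cnj u)) has_vector_derivative 0) (at t within {0..T})"
  proof (rule has_vector_derivative_transform[OF t])
    show "((\<lambda>_. 0::real) has_vector_derivative 0) (at t within {0..T})" by simp
    fix x assume "x \<in> {0..T}"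
    then obtain r where "q x = r *\<^sub>R u" using u by blast
    then show "Im (q x * cnj u) = 0" by simp
  qed
  have "Im (v t * cnj u) = 0"
    by (rule vector_derivative_unique_within[OF _ A B]) (use t T in \<open>simp add: trivial_limit_within islimpt_Icc\<close>)
  then have "v t * cnj u = of_real (Re (v t * cnj u))" by (simp add: complex_eq_iff)
  then have "v t * (cnj u * u) = of_real (Re (v t * cnj u)) * u" by (metis mult.assoc)
  moreover have "cnj u * u = of_real ((norm u)\<^sup>2)" by (metis complex_norm_square mult.commute)
  ultimately have "v t * of_real ((norm u)\<^sup>2) = of_real (Re (v t * cnj u)) * u" by (simp only:)
  then have "v t = (Re (v t * cnj u) / (norm u)\<^sup>2) *\<^sub>R u"
    using u0 by (simp add: scaleR_conv_of_real field_simps)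
  then obtain p where p: "v t = p *\<^sub>R u" by blast
  have "ecc t = (p\<^sup>2 * (norm u)\<^sup>2 * r - 1 / norm u - r * p * (norm u)\<^sup>2 * p) *\<^sub>R u"
    using r0 u0 by (simp add: ecc_def virial_def p r(2) power_mult_distrib algebra_simps power2_norm_eq_inner)
  also have "\<dots> = - (1 / norm u) *\<^sub>R u" by (simp add: power2_eq_square)
  finally show ?thesis by (simp add: sgn_div_norm inverse_eq_divide)
qed

text \<open>Without collisions this is conservation of the eccentricity (Laplace-Runge-Lenz) vector.
  Continuity cannot carry it through a collision, where \<open>ecc\<close> takes the value 0; there
  the ray condition identifies the vector outright on both sides.\<close>

lemma ecc_const:
  assumes "t \<in> {0..T}" "q t \<noteq> 0" shows "ecc t = ecc 0"
proof (cases "\<exists>t \<in> {0..T}. q t = 0")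
  case True
  then obtain u where u: "\<And>t. t \<in> {0..T} \<Longrightarrow> \<exists>s\<ge>0. q t = s *\<^sub>R u" using ray by meson
  have "ecc t = - sgn u" "ecc 0 = - sgn u" using ecc_rectilinear[OF _ _ u] assms q0 T by auto
  then show ?thesis by simp
next
  case False
  show ?thesis
  proof (rule constant_off_finite[of "{}" T ecc])
    show "continuous_on {0..T} ecc"
      using d_ecc False by (intro continuous_on_vector_derivative) auto
    show "t \<in> {0..T}" by fact
  qed (use d_ecc False in auto)
qed

text \<open>The oscillator with matching initial data gives \<open>Z\<close>, and the error
  \<open>q - Z^2\<close> obeys a homogeneous linear equation with zero initial data away from
  finitely many collisions, hence vanishes throughout. No branch of the square root has to be
  selected along \<open>q\<close>.\<close>

lemma levi_civita_lift:
  assumes a: "q 0 = a\<^sup>2"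
  obtains b k H where "2 * ((norm b)\<^sup>2 + k * (norm a)\<^sup>2) = 1" "0 < H" "T = lc_time a b k H"
    "\<And>t. t \<in> {0..T} \<Longrightarrow> q t = kepler_curve a b k t"
proof -
  define k where "k = - E / 2"
  \<comment> \<open>Solves \<open>v = 2 z z' / |z|^2\<close> for \<open>z'\<close> at
    \<open>z = a\<close>.\<close>
  define b where "b = v 0 * cnj a / 2"
  \<comment> \<open>Squaring doubles the frequency, so products of solutions for \<open>k\<close>
    carry the parameter \<open>4 * k\<close>; this is \<open>- 2 * E\<close>, as in the linear
    system for \<open>q\<close>.\<close>
  define l where "l = 4 * k"
  have a0: "a \<noteq> 0" using a q0 by auto
  have T0: "0 \<in> {0..T}" using T by simp
  have E0: "norm (v 0) ^ 2 / 2 - 1 / (norm a)\<^sup>2 = E" using en[OF T0 q0] by (simp add: a norm_power)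
  have energy: "2 * ((norm b)\<^sup>2 + k * (norm a)\<^sup>2) = 1"
    using a0 by (simp add: b_def k_def E0[symmetric] norm_mult norm_divide power_mult_distrib power_divide field_simps)
  have e0: "ecc 0 = - 2 * (b\<^sup>2 + k *\<^sub>R a\<^sup>2)"
  proof -
    have ip: "complex_of_real (2 * virial 0) = a\<^sup>2 * cnj (v 0) + cnj a ^ 2 * v 0"
      unfolding virial_def a by (simp add: complex_eq_iff inner_complex_def power2_eq_square)
    have vv: "complex_of_real ((norm (v 0))\<^sup>2) = v 0 * cnj (v 0)" by (rule complex_norm_square)
    have "- 2 * (b\<^sup>2 + k *\<^sub>R a\<^sup>2) = - (v 0)\<^sup>2 * (cnj a)\<^sup>2 / 2 + (norm (v 0) ^ 2 / 2 - 1 / (norm a)\<^sup>2) *\<^sub>R a\<^sup>2"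
      by (simp add: b_def k_def E0 power_mult_distrib power_divide scaleR_conv_of_real algebra_simps)
    also have "\<dots> = - (v 0)\<^sup>2 * (cnj a)\<^sup>2 / 2 + complex_of_real ((norm (v 0))\<^sup>2) / 2 * a\<^sup>2 - (1 / (norm a)\<^sup>2) *\<^sub>R a\<^sup>2"
      by (simp add: scaleR_conv_of_real algebra_simps)
    also have "\<dots> = complex_of_real ((norm (v 0))\<^sup>2) * a\<^sup>2 - (1 / (norm a)\<^sup>2) *\<^sub>R a\<^sup>2 - complex_of_real (2 * virial 0) / 2 * v 0"
      unfolding ip vv by (simp add: field_simps power2_eq_square)
    also have "\<dots> = ecc 0"
      by (simp add: ecc_def a norm_power scaleR_conv_of_real algebra_simps)
    finally show ?thesis by simp
  qed
  define Z where "Z t = lc_pos a b k (ftime t)" for t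
  define Zd where "Zd t = lc_vel a b k (ftime t)" for t
  \<comment> \<open>\<open>Y1\<close> below is the derivative of \<open>Y\<close> in regularised
    time. The source term \<open>- ecc\<close> in the system for \<open>q\<close> and the one in the
    system for \<open>Z^2\<close> are both \<open>2 (b^2 + k a^2)\<close>, so they cancel in the
    difference.\<close>
  define Y where "Y t = q t - Z t * Z t" for t
  define Y1 where "Y1 t = w t - 2 * (Z t * Zd t)" for t
  let ?F = "{t \<in> {0..T}. q t = 0}"
  have s0: "ftime 0 = 0" by (simp add: ftime_def)
  have cs: "continuous_on {0..T} ftime"
    unfolding ftime_def[abs_def] by (intro continuous_intros continuous_on_virial)
  have cZ: "continuous_on {0..T} Z" "continuous_on {0..T} Zd"
    unfolding Z_def[abs_def] Zd_def[abs_def]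
    by (auto intro!: continuous_on_compose2[OF continuous_on_lc_pos[of UNIV] cs] continuous_on_compose2[OF continuous_on_lc_vel[of UNIV] cs])
  have cY: "continuous_on {0..T} Y" "continuous_on {0..T} Y1"
    unfolding Y_def[abs_def] Y1_def[abs_def] by (intro continuous_intros cZ cont continuous_on_w)+
  have ccs: "continuous_on {0..T} (\<lambda>t. cosk l (ftime t))" "continuous_on {0..T} (\<lambda>t. sink l (ftime t))"
    by (auto intro!: continuous_on_compose2[OF DERIV_continuous_on[OF has_real_derivative_cosk] cs, of UNIV]
        continuous_on_compose2[OF DERIV_continuous_on[OF has_real_derivative_sink] cs, of UNIV])
  have dZ: "(Z has_vector_derivative (1 / norm (q t)) *\<^sub>R Zd t) (at t within {0..T})"
    "(Zd has_vector_derivative (1 / norm (q t)) *\<^sub>R (- k *\<^sub>R Z t)) (at t within {0..T})"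
    if "t \<in> {0..T}" "q t \<noteq> 0" for t
    using vector_diff_chain_within[OF d_ftime[OF that, unfolded has_real_derivative_iff_has_vector_derivative] has_vector_derivative_lc_pos]
      vector_diff_chain_within[OF d_ftime[OF that, unfolded has_real_derivative_iff_has_vector_derivative] has_vector_derivative_lc_vel]
    by (simp_all add: Z_def[abs_def] Zd_def[abs_def] o_def)
  have dY: "(Y has_vector_derivative (1 / norm (q t)) *\<^sub>R Y1 t) (at t within {0..T})"
    if t: "t \<in> {0..T}" "q t \<noteq> 0" for t
  proof -
    have "(Y has_vector_derivative v t - (Z t * ((1 / norm (q t)) *\<^sub>R Zd t) + ((1 / norm (q t)) *\<^sub>R Zd t) * Z t)) (at t within {0..T})"
      unfolding Y_def[abs_def] by (intro has_vector_derivative_diff has_vector_derivative_mult dZ dq t)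
    moreover have "v t - (Z t * ((1 / norm (q t)) *\<^sub>R Zd t) + ((1 / norm (q t)) *\<^sub>R Zd t) * Z t) = (1 / norm (q t)) *\<^sub>R Y1 t"
      using t by (simp add: Y1_def w_def scaleR_diff_right scaleR_conv_of_real field_simps)
    ultimately show ?thesis by metis
  qed
  have dY1: "(Y1 has_vector_derivative - (l * (1 / norm (q t))) *\<^sub>R Y t) (at t within {0..T})"
    if t: "t \<in> {0..T}" "q t \<noteq> 0" for t
  proof -
    let ?d = "1 / norm (q t)"
    have "(Y1 has_vector_derivative ?d *\<^sub>R ((2 * E) *\<^sub>R q t - ecc t)
        - 2 * (Z t * (?d *\<^sub>R (- k *\<^sub>R Z t)) + (?d *\<^sub>R Zd t) * Zd t)) (at t within {0..T})"
      unfolding Y1_def[abs_def]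
      by (intro has_vector_derivative_diff has_vector_derivative_mult_right has_vector_derivative_mult dZ d_w t)
    moreover have "?d *\<^sub>R ((2 * E) *\<^sub>R q t - ecc t) - 2 * (Z t * (?d *\<^sub>R (- k *\<^sub>R Z t)) + (?d *\<^sub>R Zd t) * Zd t)
       = - (l * ?d) *\<^sub>R Y t"
    proof -
      have en: "Zd t * Zd t + k *\<^sub>R (Z t * Z t) = b\<^sup>2 + k *\<^sub>R a\<^sup>2"
        using lc_pos_complex_energy[of a b k "ftime t"] by (simp add: Z_def Zd_def power2_eq_square)
      have "?d *\<^sub>R ((2 * E) *\<^sub>R q t - ecc t) - 2 * (Z t * (?d *\<^sub>R (- k *\<^sub>R Z t)) + (?d *\<^sub>R Zd t) * Zd t)
        = ?d *\<^sub>R ((2 * E) *\<^sub>R q t - ecc t - 2 * (Zd t * Zd t - k *\<^sub>R (Z t * Z t)))"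
        by (simp add: algebra_simps scaleR_conv_of_real)
      also have "\<dots> = ?d *\<^sub>R ((2 * E) *\<^sub>R q t - (- 2 * (Zd t * Zd t + k *\<^sub>R (Z t * Z t))) - 2 * (Zd t * Zd t - k *\<^sub>R (Z t * Z t)))"
        unfolding ecc_const[OF t] e0 en ..
      also have "\<dots> = - (l * ?d) *\<^sub>R Y t"
        by (simp add: Y_def l_def k_def scaleR_conv_of_real algebra_simps diff_divide_distrib)
      finally show ?thesis .
    qed
    ultimately show ?thesis by metis
  qed
  have Y0: "Y 0 = 0" "Y1 0 = 0"
  proof -
    show "Y 0 = 0" by (simp add: Y_def Z_def s0 a power2_eq_square)
    have "complex_of_real ((norm a)\<^sup>2) = a * cnj a" by (rule complex_norm_square)
    then show "Y1 0 = 0" by (simp add: Y1_def w_def Z_def Zd_def s0 a norm_power b_def scaleR_conv_of_real)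
  qed
  have Yz: "Y t = 0" if t: "t \<in> {0..T}" for t
  proof (rule oscillator_zero[of l "ftime t"])
    have "cosk l (ftime t) *\<^sub>R Y t - sink l (ftime t) *\<^sub>R Y1 t = cosk l (ftime 0) *\<^sub>R Y 0 - sink l (ftime 0) *\<^sub>R Y1 0"
      by (rule constant_off_finite[where f = "\<lambda>t. cosk l (ftime t) *\<^sub>R Y t - sink l (ftime t) *\<^sub>R Y1 t", OF fin _ t])
        (auto intro!: continuous_intros cY ccs oscillator_invariants d_ftime dY dY1)
    then show "cosk l (ftime t) *\<^sub>R Y t - sink l (ftime t) *\<^sub>R Y1 t = 0" by (simp add: Y0)
    have "(l * sink l (ftime t)) *\<^sub>R Y t + cosk l (ftime t) *\<^sub>R Y1 t = (l * sink l (ftime 0)) *\<^sub>R Y 0 + cosk l (ftime 0) *\<^sub>R Y1 0"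
      by (rule constant_off_finite[where f = "\<lambda>t. (l * sink l (ftime t)) *\<^sub>R Y t + cosk l (ftime t) *\<^sub>R Y1 t", OF fin _ t])
        (auto intro!: continuous_intros cY ccs oscillator_invariants d_ftime dY dY1)
    then show "(l * sink l (ftime t)) *\<^sub>R Y t + cosk l (ftime t) *\<^sub>R Y1 t = 0" by (simp add: Y0)
  qed
  then have qZ: "q t = (lc_pos a b k (ftime t))\<^sup>2" if "t \<in> {0..T}" for t
    using that by (simp add: Y_def Z_def power2_eq_square)
  \<comment> \<open>Off collisions \<open>lc_time\<close> composed with \<open>ftime\<close> has
    derivative \<open>|Z|^2 / |q| = 1\<close>.\<close>
  have th: "lc_time a b k (ftime t) = t" if t: "t \<in> {0..T}" for t
  proof -
    have "lc_time a b k (ftime t) - t = lc_time a b k (ftime 0) - 0"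
    proof (rule constant_off_finite[where f = "\<lambda>t. lc_time a b k (ftime t) - t", OF fin _ t])
      show "continuous_on {0..T} (\<lambda>t. lc_time a b k (ftime t) - t)"
        by (intro continuous_intros continuous_on_compose2[OF DERIV_continuous_on[OF has_real_derivative_lc_time] cs, of UNIV]) auto
      fix x assume x: "x \<in> {0..T} - ?F"
      have "((\<lambda>t. lc_time a b k (ftime t) - t) has_real_derivative
          (norm (lc_pos a b k (ftime x)))\<^sup>2 * (1 / norm (q x)) - 1) (at x within {0..T})"
        using x by (intro DERIV_diff DERIV_ident DERIV_chain2[OF has_real_derivative_lc_time] d_ftime) auto
      moreover have "(norm (lc_pos a b k (ftime x)))\<^sup>2 * (1 / norm (q x)) - 1 = 0"
        using x qZ[of x] by (simp add: norm_power)
      ultimately show "((\<lambda>t. lc_time a b k (ftime t) - t) has_vector_derivative 0) (at x within {0..T})"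
        by (metis has_real_derivative_iff_has_vector_derivative)
    qed
    then show ?thesis by (simp add: s0)
  qed
  have TT: "T \<in> {0..T}" using T by simp
  show ?thesis
  proof (rule that[OF energy])
    show "T = lc_time a b k (ftime T)" using th[OF TT] by simp
    show "0 < ftime T" using lc_time_less_iff[OF energy, of 0 "ftime T"] th[OF TT] T by simp
    fix t assume t: "t \<in> {0..T}"
    show "q t = kepler_curve a b k t"
      using qZ[OF t] kepler_curve_lc_time[OF energy, of "ftime t"] th[OF t] by simp
  qed
qed

end

lemma ckepler_arc_lift:
  assumes "ckepler_arc q T" "q 0 = a\<^sup>2" "a \<noteq> 0"
  obtains b k H where "2 * ((norm b)\<^sup>2 + k * (norm a)\<^sup>2) = 1" "0 < H" "T = lc_time a b k H"
    "\<And>t. t \<in> {0..T} \<Longrightarrow> q t = kepler_curve a b k t"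
proof -
  obtain v E where vE: "\<forall>t \<in> {0..T}. q t \<noteq> 0 \<longrightarrow>
        (q has_vector_derivative v t) (at t within {0..T}) \<and>
        (v has_vector_derivative (- (1 / norm (q t) ^ 3) *\<^sub>R q t)) (at t within {0..T}) \<and>
        norm (v t) ^ 2 / 2 - 1 / norm (q t) = E"
    using assms(1) unfolding ckepler_arc_def by blast
  have cosk: "ckepler q v T E"
    by unfold_locales (use assms vE in \<open>simp_all add: ckepler_arc_def\<close>)
  show ?thesis by (rule ckepler.levi_civita_lift[where q = q, OF cosk assms(2)]) (rule that)
qed

section \<open>The boundary value problem\<close>

lemma cosk_sq_int_minus [simp]: "cosk_sq_int k (- s) = - cosk_sq_int k s"
  by (simp add: cosk_sq_int_def field_simps)
lemma sink_sq_int_minus [simp]: "sink_sq_int k (- s) = - sink_sq_int k s"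
  by (simp add: sink_sq_int_def)

lemma lc_pos_uminus: "lc_pos (- a) (- b) k s = - lc_pos a b k s" and lc_time_uminus: "lc_time (- a) (- b) k s = lc_time a b k s"
  by (simp_all add: lc_pos_def lc_time_def)

text \<open>Orthogonality means \<open>z = \<i> x a\<close> with \<open>x\<close> real, so
  \<open>z^2 = - x^2 a^2\<close> lies on the opposite ray, or at the centre. The weights are those
  that balance \<open>a^2\<close> against \<open>- x^2 a^2\<close>.\<close>

lemma orthogonal_squares_hull:
  fixes a z :: complex
  assumes "a \<bullet> z = 0" "a \<noteq> 0" "a\<^sup>2 \<in> S" "z\<^sup>2 \<in> S"
  shows "0 \<in> convex hull S"
proof -
  define x where "x = Im (z * cnj a) / (norm a)\<^sup>2"
  have "Re (z * cnj a) = 0" using assms(1) by (simp add: inner_complex_def algebra_simps)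
  then have "z * cnj a = \<i> * of_real (Im (z * cnj a))" by (simp add: complex_eq_iff)
  then have "z * (cnj a * a) = \<i> * of_real (Im (z * cnj a)) * a" by (metis mult.assoc)
  moreover have "cnj a * a = of_real ((norm a)\<^sup>2)" by (metis complex_norm_square mult.commute)
  ultimately have "z * of_real ((norm a)\<^sup>2) = \<i> * of_real (Im (z * cnj a)) * a" by simp
  then have z: "z = \<i> * of_real x * a" using assms(2) by (simp add: x_def field_simps)
  have "z\<^sup>2 = - (x\<^sup>2) *\<^sub>R a\<^sup>2"
    unfolding z by (simp add: power_mult_distrib scaleR_conv_of_real)
  then have "(x\<^sup>2 / (1 + x\<^sup>2)) *\<^sub>R a\<^sup>2 + (1 / (1 + x\<^sup>2)) *\<^sub>R z\<^sup>2 = 0" by simp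
  moreover have "(x\<^sup>2 / (1 + x\<^sup>2)) *\<^sub>R a\<^sup>2 + (1 / (1 + x\<^sup>2)) *\<^sub>R z\<^sup>2 \<in> convex hull S"
  proof (rule convexD[OF convex_convex_hull])
    have "1 + x\<^sup>2 > 0" by (simp add: add_pos_nonneg)
    then show "x\<^sup>2 / (1 + x\<^sup>2) + 1 / (1 + x\<^sup>2) = 1" by (simp add: add_divide_distrib[symmetric] add.commute)
  qed (use assms in \<open>simp_all add: hull_inc\<close>)
  ultimately show ?thesis by simp
qed

text \<open>Over half a period of \<open>z\<close> the curve meets the line orthogonal to \<open>a\<close>, so its square meets the ray
  opposite to \<open>a\<^sup>2\<close>: this makes an arc longer than a period indirect.\<close>

lemma span_less_period:
  assumes energy: "2 * ((norm b)\<^sup>2 + k * (norm a)\<^sup>2) = 1" and a: "a \<noteq> 0" and H: "0 < H"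
    and simple: "\<not> cmulti_revolution (kepler_curve a b k) (lc_time a b k H)"
    and ne: "(lc_pos a b k H)\<^sup>2 \<noteq> a\<^sup>2"
  shows "k * H\<^sup>2 < pi\<^sup>2"
proof (rule ccontr)
  assume "\<not> ?thesis"
  then have ge: "pi\<^sup>2 \<le> k * H\<^sup>2" by simp
  have k: "0 < k"
  proof (rule ccontr)
    assume "\<not> 0 < k"
    then have "k * H\<^sup>2 \<le> 0" by (simp add: mult_nonpos_nonneg)
    then show False using ge pi_gt_zero by (smt (verit) zero_less_power)
  qed
  \<comment> \<open>Half the period of the lift: \<open>z\<close> changes sign after
    \<open>p\<close>, so its square repeats.\<close>
  define p where "p = pi / sqrt k"
  have p0: "0 < p" using k by (simp add: p_def)
  have "pi\<^sup>2 \<le> (sqrt k * H)\<^sup>2" using ge k by (simp add: power_mult_distrib)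
  then have "pi \<le> sqrt k * H" by (rule power2_le_imp_le) (use H k in simp)
  then have "p \<le> H" using k by (simp add: p_def field_simps)
  have cosk: "cosk k p = -1" "sink k p = 0" using k by (simp_all add: cosk_pos_eq sink_pos_eq p_def)
  then have zp: "lc_pos a b k p = - a" "lc_vel a b k p = - b" by (simp_all add: lc_pos_def lc_vel_def)
  \<comment> \<open>At \<open>p\<close> the lift is at \<open>- a\<close>, whose square is the
    starting point, whereas the arc ends elsewhere.\<close>
  then have "p \<noteq> H" using ne by auto
  with \<open>p \<le> H\<close> have pH: "p < H" by simp
  have per: "lc_pos a b k (s + p) = - lc_pos a b k s" "lc_time a b k (s + p) = lc_time a b k s + lc_time a b k p" for s
    using lc_pos_shift[of a b k p s] lc_time_shift[of a b k p s] by (simp_all add: zp lc_pos_uminus lc_time_uminus add.commute)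
  let ?T = "lc_time a b k H" and ?P = "lc_time a b k p" and ?q = "kepler_curve a b k"
  have P: "0 < ?P" "?P < ?T"
    using lc_time_less_iff[OF energy, of 0 p] lc_time_less_iff[OF energy, of p H] p0 pH by auto
  \<comment> \<open>The inner product with \<open>a\<close> passes from \<open>|a|^2\<close> to
    \<open>- |a|^2\<close>.\<close>
  have "\<exists>s\<ge>0. s \<le> p \<and> - (a \<bullet> lc_pos a b k s) = 0"
  proof (rule IVT')
    show "continuous_on {0..p} (\<lambda>s. - (a \<bullet> lc_pos a b k s))" by (intro continuous_intros continuous_on_lc_pos)
  qed (use p0 zp in auto)
  then obtain s where s: "0 \<le> s" "s \<le> p" "a \<bullet> lc_pos a b k s = 0" by auto
  have img: "(lc_pos a b k x)\<^sup>2 \<in> ?q ` {0..?T}" if "0 \<le> x" "x \<le> H" for x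
  proof
    show "(lc_pos a b k x)\<^sup>2 = ?q (lc_time a b k x)" by (simp add: kepler_curve_lc_time[OF energy])
    show "lc_time a b k x \<in> {0..?T}"
      using lc_time_le_iff[OF energy, of 0 x] lc_time_le_iff[OF energy, of x H] that by simp
  qed
  have "0 \<in> convex hull (?q ` {0..?T})"
    using orthogonal_squares_hull[OF s(3) a, of "?q ` {0..?T}"] img[of 0] img[of s] H s pH by simp
  moreover have "?q (t + ?P) = ?q t" if t: "t \<in> {0..?T}" for t
  proof -
    obtain x where "t = lc_time a b k x" using lc_time_onto[OF energy _ t] H by auto
    then show ?thesis
      by (simp add: per(2)[symmetric] kepler_curve_lc_time[OF energy] per(1))
  qed
  ultimately have "cmulti_revolution ?q ?T" using P unfolding cmulti_revolution_def by blast
  then show False using simple by simp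
qed

section \<open>Lambert's problem for the lift\<close>

definition lambert_solution :: "complex \<Rightarrow> complex \<Rightarrow> real \<Rightarrow> complex \<Rightarrow> real \<Rightarrow> real \<Rightarrow> bool" where
  "lambert_solution a c T b k H \<longleftrightarrow> 2 * ((norm b)\<^sup>2 + k * (norm a)\<^sup>2) = 1 \<and> 0 < H \<and> k * H\<^sup>2 < pi\<^sup>2 \<and>
     lc_pos a b k H = c \<and> lc_time a b k H = T"

lemma cosk_scale: "cosk k h = cosk (k * h\<^sup>2) 1" and sink_scale: "sink k h = h * sink (k * h\<^sup>2) 1"
  and sink_sq_int_scale: "sink_sq_int k h = h ^ 3 * sink_sq_int (k * h\<^sup>2) 1"
  by (simp_all add: cosk_def sink_def sink_sq_int_def)

lemma cosk_sq_int_scale: "cosk_sq_int k h = h * cosk_sq_int (k * h\<^sup>2) 1"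
  using cosk_scale[of k h] sink_scale[of k h] by (simp add: cosk_sq_int_def field_simps)

text \<open>The mixed term in \<open>m\<close> and \<open>d\<close> is even in \<open>h\<close> and
  drops out of the difference, so the directions of \<open>m\<close> and \<open>d\<close> do not
  enter the flight time.\<close>

lemma lc_time_symmetric_span:
  "lc_time m d k h - lc_time m d k (- h) = 2 * ((norm m)\<^sup>2 * cosk_sq_int k h + (norm d)\<^sup>2 * sink_sq_int k h)"
  by (simp add: lc_time_def algebra_simps)

lemma midpoint_energy_time:
  fixes P Q m d :: complex
  assumes h: "0 < h" and kh: "k * h\<^sup>2 < (pi / 2)\<^sup>2"
    and P: "cosk k h *\<^sub>R m = P" and Q: "sink k h *\<^sub>R d = Q"
  shows "2 * ((norm d)\<^sup>2 + k * (norm m)\<^sup>2) = half_span_sq ((norm P)\<^sup>2) ((norm Q)\<^sup>2) (k * h\<^sup>2) / h\<^sup>2" (is ?E)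
    and "lc_time m d k h - lc_time m d k (- h) = 2 * h * mean_radius ((norm P)\<^sup>2) ((norm Q)\<^sup>2) (k * h\<^sup>2)" (is ?T)
proof -
  have C: "0 < cosk (k * h\<^sup>2) 1" and S: "0 < sink (k * h\<^sup>2) 1"
    using kh by (auto intro: cosk_pos_unit sink_pos_unit)
  have m: "(norm m)\<^sup>2 = (norm P)\<^sup>2 / (cosk (k * h\<^sup>2) 1)\<^sup>2"
    using C by (simp add: P[symmetric] cosk_scale[of k h] power_mult_distrib)
  have d: "(norm d)\<^sup>2 = (norm Q)\<^sup>2 / (h\<^sup>2 * (sink (k * h\<^sup>2) 1)\<^sup>2)"
    using S h by (simp add: Q[symmetric] sink_scale[of k h] power_mult_distrib)
  show ?E unfolding half_span_sq_eq[OF kh] m d using C S h by (simp add: field_simps)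
  show ?T unfolding lc_time_symmetric_span mean_radius_def m d cosk_sq_int_scale[of k h] sink_sq_int_scale[of k h]
    using C S h by (simp add: field_simps power2_eq_square power3_eq_cube)
qed

text \<open>By parity the midpoint data satisfy \<open>C m = P\<close> and \<open>S d = Q\<close>.
  Hence \<kappa> determines everything: the half length through \<open>half_span_sq\<close>, then
  \<open>k\<close>, then \<open>b\<close> by flowing back from the midpoint.\<close>

lemma lambert_solution_midpoint:
  fixes a c :: complex
  defines "P \<equiv> (1 / 2) *\<^sub>R (a + c)" and "Q \<equiv> (1 / 2) *\<^sub>R (c - a)"
  assumes sol: "lambert_solution a c T b k H"
  defines "\<kappa> \<equiv> k * (H / 2)\<^sup>2"
  shows "\<kappa> < (pi / 2)\<^sup>2" "half_span_sq ((norm P)\<^sup>2) ((norm Q)\<^sup>2) \<kappa> = (H / 2)\<^sup>2"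
    "flight_time ((norm P)\<^sup>2) ((norm Q)\<^sup>2) \<kappa> = T"
    "b = lc_vel ((1 / cosk k (H / 2)) *\<^sub>R P) ((1 / sink k (H / 2)) *\<^sub>R Q) k (- (H / 2))"
proof -
  define h where "h = H / 2"
  have en: "2 * ((norm b)\<^sup>2 + k * (norm a)\<^sup>2) = 1" and H: "0 < H" "k * H\<^sup>2 < pi\<^sup>2"
    and c: "lc_pos a b k H = c" and T: "lc_time a b k H = T"
    using sol by (auto simp: lambert_solution_def)
  have h: "0 < h" using H by (simp add: h_def)
  have kappa: "\<kappa> = k * h\<^sup>2" by (simp add: \<kappa>_def h_def)
  show kh: "\<kappa> < (pi / 2)\<^sup>2" using H by (simp add: \<kappa>_def power_divide)
  define m where "m = lc_pos a b k h"
  define d where "d = lc_vel a b k h"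
  have "lc_pos a b k (h + - h) = lc_pos m d k (- h)" unfolding m_def d_def by (rule lc_pos_shift)
  then have a: "a = cosk k h *\<^sub>R m - sink k h *\<^sub>R d" by (simp add: lc_pos_def[of m])
  have "lc_pos a b k (h + h) = lc_pos m d k h" unfolding m_def d_def by (rule lc_pos_shift)
  then have c': "c = cosk k h *\<^sub>R m + sink k h *\<^sub>R d" using c by (simp add: lc_pos_def[of m] h_def)
  have P: "cosk k h *\<^sub>R m = P" unfolding P_def a c' by (simp add: scaleR_conv_of_real)
  have Q: "sink k h *\<^sub>R d = Q" unfolding Q_def a c' by (simp add: scaleR_conv_of_real)
  have pos: "0 < cosk k h" "0 < sink k h"
    using kh h cosk_positive[of k h] sink_positive[of h k] halfpi_square_less by (simp_all add: kappa)
  have "2 * ((norm d)\<^sup>2 + k * (norm m)\<^sup>2) = 1" using en energy_lc_pos[of a b k h] by (simp add: m_def d_def)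
  then show hs: "half_span_sq ((norm P)\<^sup>2) ((norm Q)\<^sup>2) \<kappa> = (H / 2)\<^sup>2"
    using midpoint_energy_time(1)[OF h kh[unfolded kappa] P Q] h by (simp add: kappa h_def)
  have "T = lc_time m d k h - lc_time m d k (- h)"
    using lc_time_shift[of a b k h h] lc_time_shift[of a b k h "- h"] T by (simp add: m_def d_def h_def)
  also have "\<dots> = 2 * h * mean_radius ((norm P)\<^sup>2) ((norm Q)\<^sup>2) \<kappa>"
    using midpoint_energy_time(2)[OF h kh[unfolded kappa] P Q] by (simp add: kappa)
  also have "\<dots> = flight_time ((norm P)\<^sup>2) ((norm Q)\<^sup>2) \<kappa>"
    using H by (simp add: flight_time_def hs h_def)
  finally show "flight_time ((norm P)\<^sup>2) ((norm Q)\<^sup>2) \<kappa> = T" ..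
  have "lc_vel a b k (h + - h) = lc_vel m d k (- h)" unfolding m_def d_def by (rule lc_vel_shift)
  moreover have "m = (1 / cosk k h) *\<^sub>R P" "d = (1 / sink k h) *\<^sub>R Q" using P Q pos by (auto simp flip: P Q)
  ultimately show "b = lc_vel ((1 / cosk k (H / 2)) *\<^sub>R P) ((1 / sink k (H / 2)) *\<^sub>R Q) k (- (H / 2))"
    by (simp add: h_def)
qed

text \<open>The two inequalities make \<open>P\<close> and \<open>Q\<close> nonzero, so
  \<open>flight_time_ex1\<close> fixes the midpoint parameter; \<open>H\<close>, \<open>k\<close>
  and \<open>b\<close> follow in this order.\<close>

lemma lambert_solution_unique:
  assumes "a \<noteq> c" "a \<noteq> - c" "0 < T"
    and 1: "lambert_solution a c T b k H" and 2: "lambert_solution a c T b' k' H'"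
  shows "b = b' \<and> k = k' \<and> H = H'"
proof -
  define P where "P = (1 / 2) *\<^sub>R (a + c)"
  define Q where "Q = (1 / 2) *\<^sub>R (c - a)"
  have "a + c \<noteq> 0" using assms(2) by (simp add: eq_neg_iff_add_eq_0)
  then have PQ: "0 < (norm P)\<^sup>2" "0 < (norm Q)\<^sup>2" using assms(1) by (simp_all add: P_def Q_def)
  have H: "0 < H" "0 < H'" using 1 2 by (auto simp: lambert_solution_def)
  note m1 = lambert_solution_midpoint[OF 1, folded P_def Q_def]
  note m2 = lambert_solution_midpoint[OF 2, folded P_def Q_def]
  have eq: "k * (H / 2)\<^sup>2 = k' * (H' / 2)\<^sup>2"
    using flight_time_ex1[OF PQ assms(3)] m1 m2 H by (metis half_gt_zero zero_less_power)
  then have "(H / 2)\<^sup>2 = (H' / 2)\<^sup>2" using m1(2) m2(2) by simp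
  then have HH: "H = H'" using H by (simp add: power2_eq_iff_nonneg)
  then have kk: "k = k'" using eq H by simp
  show ?thesis using m1(4) m2(4) HH kk by simp
qed

lemma lambert_solution_exists:
  assumes "a \<noteq> c" "a \<noteq> - c" "0 < T"
  shows "\<exists>b k H. lambert_solution a c T b k H"
proof -
  define P where "P = (1 / 2) *\<^sub>R (a + c)"
  define Q where "Q = (1 / 2) *\<^sub>R (c - a)"
  have "a + c \<noteq> 0" using assms(2) by (simp add: eq_neg_iff_add_eq_0)
  then have PQ: "0 < (norm P)\<^sup>2" "0 < (norm Q)\<^sup>2" using assms(1) by (simp_all add: P_def Q_def)
  obtain \<kappa> where \<kappa>: "\<kappa> < (pi / 2)\<^sup>2" "0 < half_span_sq ((norm P)\<^sup>2) ((norm Q)\<^sup>2) \<kappa>"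
    "flight_time ((norm P)\<^sup>2) ((norm Q)\<^sup>2) \<kappa> = T"
    using flight_time_ex1[OF PQ assms(3)] by auto
  define h where "h = sqrt (half_span_sq ((norm P)\<^sup>2) ((norm Q)\<^sup>2) \<kappa>)"
  have h: "0 < h" "h\<^sup>2 = half_span_sq ((norm P)\<^sup>2) ((norm Q)\<^sup>2) \<kappa>" using \<kappa> by (simp_all add: h_def)
  define k where "k = \<kappa> / h\<^sup>2"
  have kh: "k * h\<^sup>2 = \<kappa>" using h(1) by (simp add: k_def)
  have pos: "0 < cosk k h" "0 < sink k h"
    using \<kappa> h kh cosk_positive[of k h] sink_positive[of h k] halfpi_square_less by simp_all
  define m where "m = (1 / cosk k h) *\<^sub>R P"
  define d where "d = (1 / sink k h) *\<^sub>R Q"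
  have P: "cosk k h *\<^sub>R m = P" and Q: "sink k h *\<^sub>R d = Q" using pos by (simp_all add: m_def d_def)
  have "P - Q = a" "P + Q = c" by (simp_all add: P_def Q_def scaleR_conv_of_real field_simps)
  then have a: "a = lc_pos m d k (- h)" and c: "c = lc_pos m d k h" using P Q by (simp_all add: lc_pos_def)
  define b where "b = lc_vel m d k (- h)"
  note mid = midpoint_energy_time[OF h(1) \<kappa>(1)[folded kh] P Q]
  have "2 * ((norm d)\<^sup>2 + k * (norm m)\<^sup>2) = 1" using mid(1) h(1) unfolding kh h(2)[symmetric] by simp
  then have "2 * ((norm b)\<^sup>2 + k * (norm a)\<^sup>2) = 1" using energy_lc_pos[of m d k "- h"] by (simp add: a b_def)
  moreover have "k * (2 * h)\<^sup>2 < pi\<^sup>2" using \<kappa>(1) by (simp add: kh[symmetric] power_mult_distrib power_divide)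
  moreover have "lc_pos a b k (2 * h) = c"
    using lc_pos_shift[of m d k "- h" "2 * h"] c by (simp add: a b_def)
  moreover have "lc_time a b k (2 * h) = T"
  proof -
    have "lc_time a b k (2 * h) = lc_time m d k h - lc_time m d k (- h)"
      using lc_time_shift[of m d k "- h" "2 * h"] by (simp add: a b_def)
    also have "\<dots> = T" unfolding mid(2) kh using \<kappa>(3) by (simp add: flight_time_def h_def)
    finally show ?thesis .
  qed
  ultimately have "lambert_solution a c T b k (2 * h)" using h by (simp add: lambert_solution_def)
  then show ?thesis by blast
qed

section \<open>Simple arcs as projected solutions\<close>

definition csimple_arc_between :: "complex \<Rightarrow> complex \<Rightarrow> real \<Rightarrow> (real \<Rightarrow> complex) \<Rightarrow> bool" where
  "csimple_arc_between A B T q \<longleftrightarrow> ckepler_arc q T \<and> \<not> cmulti_revolution q T \<and> q 0 = A \<and> q T = B"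

lemma csimple_arc_of_lambert_solution:
  assumes "lambert_solution a c T b k H" "a \<noteq> 0"
  shows "csimple_arc_between (a\<^sup>2) (c\<^sup>2) T (kepler_curve a b k)"
proof -
  have en: "2 * ((norm b)\<^sup>2 + k * (norm a)\<^sup>2) = 1" and H: "0 < H" "k * H\<^sup>2 < pi\<^sup>2"
    and c: "lc_pos a b k H = c" and T: "lc_time a b k H = T"
    using assms by (auto simp: lambert_solution_def)
  show ?thesis unfolding csimple_arc_between_def
    using kepler_curve_arc[OF en H] kepler_curve_not_multi_revolution[OF en H assms(2)]
      kepler_curve_lc_time[OF en, of 0] kepler_curve_lc_time[OF en, of H] c T by simp
qed

lemma cmulti_revolution_cong:
  assumes "\<And>t. t \<in> {0..T} \<Longrightarrow> q t = q' t"
  shows "cmulti_revolution q T \<longleftrightarrow> cmulti_revolution q' T"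
proof -
  have "q ` {0..T} = q' ` {0..T}" by (rule image_cong[OF refl assms])
  moreover have "(\<forall>t. t \<in> {0..T} \<and> t + P \<in> {0..T} \<longrightarrow> q (t + P) = q t) \<longleftrightarrow>
      (\<forall>t. t \<in> {0..T} \<and> t + P \<in> {0..T} \<longrightarrow> q' (t + P) = q' t)" for P
    using assms by metis
  ultimately show ?thesis unfolding cmulti_revolution_def by simp
qed

text \<open>The lift starts at \<open>a\<close> but may end at either root of \<open>c^2\<close>;
  \<open>e\<close> records which. Simplicity enters through \<open>span_less_period\<close>.\<close>

lemma lambert_solution_of_csimple_arc:
  assumes q: "csimple_arc_between (a\<^sup>2) (c\<^sup>2) T q" and "a \<noteq> 0" "a\<^sup>2 \<noteq> c\<^sup>2"
  obtains b k H e where "e = c \<or> e = - c" "lambert_solution a e T b k H"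
    "\<And>t. t \<in> {0..T} \<Longrightarrow> q t = kepler_curve a b k t"
proof -
  have "ckepler_arc q T" "q 0 = a\<^sup>2" using q by (simp_all add: csimple_arc_between_def)
  then obtain b k H where en: "2 * ((norm b)\<^sup>2 + k * (norm a)\<^sup>2) = 1" and H: "0 < H" and T: "T = lc_time a b k H"
    and eq: "\<And>t. t \<in> {0..T} \<Longrightarrow> q t = kepler_curve a b k t"
    using ckepler_arc_lift[OF _ _ assms(2)] by metis
  have T0: "0 < T" using q by (simp add: csimple_arc_between_def ckepler_arc_def)
  have "kepler_curve a b k T = c\<^sup>2" using eq[of T] T0 q by (simp add: csimple_arc_between_def)
  then have cc: "(lc_pos a b k H)\<^sup>2 = c\<^sup>2" unfolding T kepler_curve_lc_time[OF en] .
  have "\<not> cmulti_revolution (kepler_curve a b k) (lc_time a b k H)"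
    using q cmulti_revolution_cong[OF eq] by (simp add: csimple_arc_between_def flip: T)
  then have "k * H\<^sup>2 < pi\<^sup>2" using span_less_period[OF en assms(2) H] cc assms(3) by simp
  then have "lambert_solution a (lc_pos a b k H) T b k H" using en H T by (simp add: lambert_solution_def)
  moreover have "lc_pos a b k H = c \<or> lc_pos a b k H = - c" using cc by (simp add: power2_eq_iff)
  ultimately show ?thesis using eq by (intro that)
qed

text \<open>Equal curves have equal initial velocities, which give \<open>b\<close> for the fixed
  root \<open>a\<close>; the energy relation then gives \<open>k\<close>, injectivity of time gives
  \<open>H\<close>, and both lifts end at the same root.\<close>

lemma csimple_arcs_distinct:
  assumes 1: "lambert_solution a c T b k H" and 2: "lambert_solution a c' T b' k' H'"
    and "a \<noteq> 0" "0 < T" and eq: "\<And>t. t \<in> {0..T} \<Longrightarrow> kepler_curve a b k t = kepler_curve a b' k' t"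
  shows "c = c'"
proof -
  have en: "2 * ((norm b)\<^sup>2 + k * (norm a)\<^sup>2) = 1" "2 * ((norm b')\<^sup>2 + k' * (norm a)\<^sup>2) = 1"
    using 1 2 unfolding lambert_solution_def by blast+
  have "kepler_velocity a b k 0 = kepler_velocity a b' k' 0"
  proof (rule vector_derivative_unique_within)
    show "at 0 within {0..T} \<noteq> bot" using assms by (simp add: trivial_limit_within islimpt_Icc)
    show "(kepler_curve a b k has_vector_derivative kepler_velocity a b k 0) (at 0 within {0..T})"
      using kepler_curve_has_derivative[OF en(1), of 0] assms by (auto intro: has_vector_derivative_at_within)
    have "(kepler_curve a b' k' has_vector_derivative kepler_velocity a b' k' 0) (at 0 within {0..T})"
      using kepler_curve_has_derivative[OF en(2), of 0] assms by (auto intro: has_vector_derivative_at_within)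
    then show "(kepler_curve a b k has_vector_derivative kepler_velocity a b' k' 0) (at 0 within {0..T})"
      by (rule has_vector_derivative_transform[rotated 2]) (use assms in auto)
  qed
  then have bb: "b = b'" using assms by (simp add: kepler_velocity_def)
  have "2 * (k * (norm a)\<^sup>2) = 2 * (k' * (norm a)\<^sup>2)" using en unfolding bb distrib_left by linarith
  then have kk: "k = k'" using \<open>a \<noteq> 0\<close> by simp
  have "lc_time a b k H = lc_time a b k H'" using 1 2 by (simp add: lambert_solution_def bb kk)
  then have "H = H'" using inj_lc_time[OF en(1)] by (simp add: inj_eq)
  then show ?thesis using 1 2 bb kk by (simp add: lambert_solution_def)
qed

text \<open>Only the sign of \<open>c\<close> separates the arcs: replacing the chosen root
  \<open>a\<close> by \<open>- a\<close> changes the sign of the whole lift, which squaring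
  forgets.\<close>

lemma two_csimple_arcs:
  fixes A B :: complex
  assumes "A \<noteq> 0" "B \<noteq> 0" "A \<noteq> B" "0 < T"
  obtains q1 q2 where "csimple_arc_between A B T q1" "csimple_arc_between A B T q2"
    "\<exists>t \<in> {0..T}. q1 t \<noteq> q2 t"
    "\<And>q. csimple_arc_between A B T q \<Longrightarrow> (\<forall>t \<in> {0..T}. q t = q1 t) \<or> (\<forall>t \<in> {0..T}. q t = q2 t)"
proof -
  define a where "a = csqrt A"
  define c where "c = csqrt B"
  have sq: "a\<^sup>2 = A" "c\<^sup>2 = B" by (simp_all add: a_def c_def)
  have nz: "a \<noteq> 0" "c \<noteq> 0" using assms sq by auto
  have ne: "a \<noteq> c" "a \<noteq> - c" using assms sq by auto
  obtain b1 k1 H1 where 1: "lambert_solution a c T b1 k1 H1"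
    using lambert_solution_exists[OF ne assms(4)] by blast
  obtain b2 k2 H2 where 2: "lambert_solution a (- c) T b2 k2 H2"
    using lambert_solution_exists[of a "- c" T] ne assms(4) by auto
  show ?thesis
  proof (rule that[of "kepler_curve a b1 k1" "kepler_curve a b2 k2"])
    show "csimple_arc_between A B T (kepler_curve a b1 k1)" "csimple_arc_between A B T (kepler_curve a b2 k2)"
      using csimple_arc_of_lambert_solution[OF 1 nz(1)] csimple_arc_of_lambert_solution[OF 2 nz(1)] sq by simp_all
    show "\<exists>t\<in>{0..T}. kepler_curve a b1 k1 t \<noteq> kepler_curve a b2 k2 t"
    proof (rule ccontr)
      assume "\<not> ?thesis"
      then have "\<And>t. t \<in> {0..T} \<Longrightarrow> kepler_curve a b1 k1 t = kepler_curve a b2 k2 t" by blast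
      from csimple_arcs_distinct[OF 1 2 nz(1) assms(4) this] show False using nz(2) by simp
    qed
    fix q assume "csimple_arc_between A B T q"
    then have q: "csimple_arc_between (a\<^sup>2) (c\<^sup>2) T q" and "a\<^sup>2 \<noteq> c\<^sup>2" using sq assms by simp_all
    then obtain b k H e where e: "e = c \<or> e = - c" "lambert_solution a e T b k H"
      and eq: "\<And>t. t \<in> {0..T} \<Longrightarrow> q t = kepler_curve a b k t"
      using lambert_solution_of_csimple_arc[OF q nz(1)] by metis
    from e(1) show "(\<forall>t \<in> {0..T}. q t = kepler_curve a b1 k1 t) \<or> (\<forall>t \<in> {0..T}. q t = kepler_curve a b2 k2 t)"
    proof
      assume "e = c"
      then have "b = b1 \<and> k = k1 \<and> H = H1"
        using e(2) 1 by (intro lambert_solution_unique[OF ne assms(4)]) simp_all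
      then show ?thesis using eq by simp
    next
      assume "e = - c"
      then have "b = b2 \<and> k = k2 \<and> H = H2"
        using e(2) 2 ne by (intro lambert_solution_unique[of a "- c", OF _ _ assms(4)]) simp_all
      then show ?thesis using eq by simp
    qed
  qed
qed

section \<open>Transfer to the Euclidean plane\<close>

definition plane_to_complex :: "real^2 \<Rightarrow> complex" where
  "plane_to_complex x = Complex (x $ 1) (x $ 2)"

definition complex_to_plane :: "complex \<Rightarrow> real^2" where
  "complex_to_plane z = (\<chi> i. if i = 1 then Re z else Im z)"

lemma plane_complex_inverse [simp]:
  "plane_to_complex (complex_to_plane z) = z" "complex_to_plane (plane_to_complex x) = x"
  by (simp_all add: plane_to_complex_def complex_to_plane_def complex_eq_iff vec_eq_iff forall_2)

lemma linear_plane_to_complex: "linear plane_to_complex"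
  by (intro linearI) (simp_all add: plane_to_complex_def complex_eq_iff)

lemma linear_complex_to_plane: "linear complex_to_plane"
  by (intro linearI) (simp_all add: complex_to_plane_def vec_eq_iff)

lemma bounded_linear_plane_to_complex: "bounded_linear plane_to_complex"
  using linear_plane_to_complex by (simp add: linear_conv_bounded_linear)

lemma bounded_linear_complex_to_plane: "bounded_linear complex_to_plane"
  using linear_complex_to_plane by (simp add: linear_conv_bounded_linear)

lemmas plane_to_complex_linear [simp] = linear_0[OF linear_plane_to_complex]
  linear_add[OF linear_plane_to_complex] linear_diff[OF linear_plane_to_complex]
  linear_cmul[OF linear_plane_to_complex]

lemma norm_plane_to_complex [simp]: "norm (plane_to_complex x) = norm x"
  by (simp add: plane_to_complex_def norm_eq_sqrt_inner inner_vec_def sum_2 inner_complex_def)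

lemma plane_to_complex_eq_iff: "plane_to_complex x = plane_to_complex y \<longleftrightarrow> x = y"
  by (metis plane_complex_inverse(2))

lemma has_vector_derivative_plane:
  "((\<lambda>t. plane_to_complex (q t - c)) has_vector_derivative plane_to_complex d) (at t within X) \<longleftrightarrow>
   (q has_vector_derivative d) (at t within X)" (is "?L \<longleftrightarrow> ?R")
proof
  assume ?L
  then have "((\<lambda>t. complex_to_plane (plane_to_complex (q t - c))) has_vector_derivative
      complex_to_plane (plane_to_complex d)) (at t within X)"
    by (rule bounded_linear.has_vector_derivative[OF bounded_linear_complex_to_plane])
  then have "((\<lambda>t. (q t - c) + c) has_vector_derivative d + 0) (at t within X)"
    unfolding plane_complex_inverse by (intro has_vector_derivative_add has_vector_derivative_const)
  then show ?R by simp
next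
  assume ?R
  then have "((\<lambda>t. q t - c) has_vector_derivative d - 0) (at t within X)"
    by (intro has_vector_derivative_diff has_vector_derivative_const)
  then have "((\<lambda>t. plane_to_complex (q t - c)) has_vector_derivative plane_to_complex (d - 0)) (at t within X)"
    by (rule bounded_linear.has_vector_derivative[OF bounded_linear_plane_to_complex])
  then show ?L by simp
qed

lemma continuous_on_plane:
  "continuous_on X (\<lambda>t. plane_to_complex (q t - c)) \<longleftrightarrow> continuous_on X q" (is "?L \<longleftrightarrow> ?R")
proof
  assume ?L
  then have "continuous_on X (\<lambda>t. complex_to_plane (plane_to_complex (q t - c)) + c)"
    by (intro continuous_intros bounded_linear.continuous_on[OF bounded_linear_complex_to_plane])
  then show ?R by (simp del: plane_to_complex_linear)
next
  assume ?R
  then show ?L by (intro continuous_intros bounded_linear.continuous_on[OF bounded_linear_plane_to_complex])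
qed

lemma kepler_arc_iff_ckepler_arc:
  "kepler_arc c q 0 T \<longleftrightarrow> ckepler_arc (\<lambda>t. plane_to_complex (q t - c)) T"
proof -
  let ?p = "\<lambda>t. plane_to_complex (q t - c)"
  let ?K = "\<lambda>v E. \<forall>t \<in> {0..T}. q t \<noteq> c \<longrightarrow> (q has_vector_derivative v t) (at t within {0..T}) \<and>
            (v has_vector_derivative (- (1 / norm (q t - c) ^ 3) *\<^sub>R (q t - c))) (at t within {0..T}) \<and>
            norm (v t) ^ 2 / 2 - 1 / norm (q t - c) = E"
  let ?C = "\<lambda>v E. \<forall>t \<in> {0..T}. ?p t \<noteq> 0 \<longrightarrow> (?p has_vector_derivative v t) (at t within {0..T}) \<and>
            (v has_vector_derivative (- (1 / norm (?p t) ^ 3) *\<^sub>R ?p t)) (at t within {0..T}) \<and>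
            norm (v t) ^ 2 / 2 - 1 / norm (?p t) = E"
  have z: "?p t = 0 \<longleftrightarrow> q t = c" for t
    by (metis plane_to_complex_eq_iff plane_to_complex_linear(1) right_minus_eq)
  have d0: "((\<lambda>t. plane_to_complex (v t)) has_vector_derivative plane_to_complex d) (at t within {0..T}) \<longleftrightarrow>
     (v has_vector_derivative d) (at t within {0..T})" for v d t
    using has_vector_derivative_plane[of v 0 d t] by simp
  have KC: "?C (\<lambda>t. plane_to_complex (v t)) E \<longleftrightarrow> ?K v E" for v E
  proof -
    have "- (1 / norm (?p t) ^ 3) *\<^sub>R ?p t = plane_to_complex (- (1 / norm (q t - c) ^ 3) *\<^sub>R (q t - c))" for t
      by (simp only: plane_to_complex_linear(4) norm_plane_to_complex)
    then show ?thesis by (simp only: z has_vector_derivative_plane d0 norm_plane_to_complex)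
  qed
  have "(\<exists>v E. ?C v E) \<longleftrightarrow> (\<exists>v E. ?K v E)"
  proof
    assume "\<exists>v E. ?C v E"
    then obtain v E where "?C v E" by blast
    then have "?C (\<lambda>t. plane_to_complex (complex_to_plane (v t))) E" by (simp only: plane_complex_inverse)
    then have "?K (\<lambda>t. complex_to_plane (v t)) E" by (rule KC[THEN iffD1])
    then show "\<exists>v E. ?K v E" by (intro exI)
  next
    assume "\<exists>v E. ?K v E"
    then obtain v E where "?K v E" by blast
    then have "?C (\<lambda>t. plane_to_complex (v t)) E" by (rule KC[THEN iffD2])
    then show "\<exists>v E. ?C v E" by (intro exI)
  qed
  moreover have "(\<exists>u. \<forall>t \<in> {0..T}. \<exists>s\<ge>0. ?p t = s *\<^sub>R u) \<longleftrightarrow> (\<exists>u. \<forall>t \<in> {0..T}. \<exists>s\<ge>0. q t - c = s *\<^sub>R u)"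
  proof -
    have eq: "?p t = s *\<^sub>R plane_to_complex u \<longleftrightarrow> q t - c = s *\<^sub>R u" for t s u
      using plane_to_complex_eq_iff[of "q t - c" "s *\<^sub>R u"] by (simp only: plane_to_complex_linear(4))
    show ?thesis using eq by (metis plane_complex_inverse(1))
  qed
  ultimately show ?thesis
    unfolding kepler_arc_def ckepler_arc_def continuous_on_plane z by (simp only:)
qed

text \<open>Convex hulls commute with the translation by \<open>- c\<close> and with the linear
  identification of the planes.\<close>

lemma multi_revolution_iff_cmulti_revolution:
  "multi_revolution c q 0 T \<longleftrightarrow> cmulti_revolution (\<lambda>t. plane_to_complex (q t - c)) T"
proof -
  let ?S = "q ` {0..T}"
  have "(\<lambda>t. plane_to_complex (q t - c)) ` {0..T} = plane_to_complex ` ((+) (- c) ` ?S)"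
    by (simp add: image_image)
  then have "convex hull ((\<lambda>t. plane_to_complex (q t - c)) ` {0..T})
     = plane_to_complex ` ((+) (- c) ` (convex hull ?S))"
    by (simp only: convex_hull_linear_image[OF linear_plane_to_complex, symmetric] convex_hull_translation)
  moreover have "0 \<in> plane_to_complex ` ((+) (- c) ` X) \<longleftrightarrow> c \<in> X" for X
  proof -
    have "0 = plane_to_complex (- c + x) \<longleftrightarrow> 0 = - c + x" for x
      using plane_to_complex_eq_iff[of 0 "- c + x"] unfolding plane_to_complex_linear(1) .
    then have "0 = plane_to_complex (- c + x) \<longleftrightarrow> x = c" for x
      by (metis add.commute diff_conv_add_uminus right_minus_eq)
    then show ?thesis unfolding image_image by (metis (no_types, lifting) image_iff)
  qed
  ultimately have "0 \<in> convex hull ((\<lambda>t. plane_to_complex (q t - c)) ` {0..T}) \<longleftrightarrow> c \<in> convex hull ?S" by simp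
  moreover have "plane_to_complex (x - c) = plane_to_complex (y - c) \<longleftrightarrow> x = y" for x y
    by (simp only: plane_to_complex_eq_iff) simp
  ultimately show ?thesis
    unfolding multi_revolution_def indirect_arc_def cmulti_revolution_def by (simp only: diff_zero)
qed

lemma simple_kepler_arc_iff:
  "simple_kepler_arc c q 0 T \<and> q 0 = A \<and> q T = B \<longleftrightarrow>
   csimple_arc_between (plane_to_complex (A - c)) (plane_to_complex (B - c)) T (\<lambda>t. plane_to_complex (q t - c))"
  unfolding simple_kepler_arc_def csimple_arc_between_def kepler_arc_iff_ckepler_arc multi_revolution_iff_cmulti_revolution
    plane_to_complex_eq_iff by (simp del: plane_to_complex_linear)

text \<open>Curves are total functions, so they are counted after \<open>restrict\<close>, which
  sets all values outside the time interval to \<open>undefined\<close>. The equation is autonomous,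
  so starting at time 0 is no loss.\<close>

theorem mainTheorem10:
  fixes c A B :: "real^2" and T :: real
  assumes "c \<noteq> A" and "c \<noteq> B" and "A \<noteq> B" and "T > 0"
  shows "card ((\<lambda>q. restrict q {0..T}) `
           {q. simple_kepler_arc c q 0 T \<and> q 0 = A \<and> q T = B}) = 2"
proof -
  define A' where "A' = plane_to_complex (A - c)"
  define B' where "B' = plane_to_complex (B - c)"
  have "A' \<noteq> plane_to_complex 0" "B' \<noteq> plane_to_complex 0" "A' \<noteq> B'"
    unfolding A'_def B'_def plane_to_complex_eq_iff using assms by auto
  then have ne: "A' \<noteq> 0" "B' \<noteq> 0" "A' \<noteq> B'" by simp_all
  obtain q1 q2 where q: "csimple_arc_between A' B' T q1" "csimple_arc_between A' B' T q2"
    "\<exists>t \<in> {0..T}. q1 t \<noteq> q2 t"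
    "\<And>q. csimple_arc_between A' B' T q \<Longrightarrow> (\<forall>t \<in> {0..T}. q t = q1 t) \<or> (\<forall>t \<in> {0..T}. q t = q2 t)"
    by (rule two_csimple_arcs[OF ne assms(4)]) blast
  define r where "r p = (\<lambda>t. c + complex_to_plane (p t))" for p :: "real \<Rightarrow> complex"
  have r_inv: "plane_to_complex (r p t - c) = p t" for p t by (simp add: r_def del: plane_to_complex_linear)
  have r_eq: "x = r p t \<longleftrightarrow> plane_to_complex (x - c) = p t" for x p t
    using plane_to_complex_eq_iff[of "x - c" "r p t - c"] unfolding r_inv by auto
  let ?X = "{q. simple_kepler_arc c q 0 T \<and> q 0 = A \<and> q T = B}"
  have X: "q \<in> ?X \<longleftrightarrow> csimple_arc_between A' B' T (\<lambda>t. plane_to_complex (q t - c))" for q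
    unfolding A'_def B'_def using simple_kepler_arc_iff[of c q T A B] by simp
  have "(\<lambda>q. restrict q {0..T}) ` ?X = {restrict (r q1) {0..T}, restrict (r q2) {0..T}}"
  proof (intro equalityI subsetI)
    fix f assume "f \<in> (\<lambda>q. restrict q {0..T}) ` ?X"
    then obtain q' where f: "f = restrict q' {0..T}" and "q' \<in> ?X" by blast
    then have "(\<forall>t \<in> {0..T}. q' t = r q1 t) \<or> (\<forall>t \<in> {0..T}. q' t = r q2 t)"
      using q(4) unfolding X r_eq by blast
    then show "f \<in> {restrict (r q1) {0..T}, restrict (r q2) {0..T}}"
      unfolding f by (auto intro!: restrict_ext)
  next
    fix f assume "f \<in> {restrict (r q1) {0..T}, restrict (r q2) {0..T}}"
    moreover have "r q1 \<in> ?X" "r q2 \<in> ?X" unfolding X r_inv using q by auto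
    ultimately show "f \<in> (\<lambda>q. restrict q {0..T}) ` ?X" by blast
  qed
  moreover have "restrict (r q1) {0..T} \<noteq> restrict (r q2) {0..T}"
  proof
    assume eq: "restrict (r q1) {0..T} = restrict (r q2) {0..T}"
    obtain t where t: "t \<in> {0..T}" "q1 t \<noteq> q2 t" using q(3) by blast
    then have "r q1 t = r q2 t" using fun_cong[OF eq, of t] by simp
    then show False using t r_inv by metis
  qed
  ultimately show ?thesis by (simp add: card_2_iff)
qed

end
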